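(* Let $\mathfrak{g}$ be a real simple Lie algebra. Then $H^2(T^*\mathfrak{g})=\{0\}$; equivalently, every derivation of $T^*\mathfrak{g}$ which is skew-symmetric with respect to its canonical quadratic form $\langle\cdot,\cdot\rangle$ is inner.
   Context: For a Lie algebra $\mathfrak{g}$, the $T^*$-extension $T^*\mathfrak{g}=\mathfrak{g}\oplus\mathfrak{g}^*$ is the Lie algebra with bracket $[u+\alpha,v+\beta]=[u,v]+\mathrm{ad}_u^*\beta-\mathrm{ad}_v^*\alpha$ for $u,v\in\mathfrak{g}$, $\alpha,\beta\in\mathfrak{g}^*$, where $(\mathrm{ad}_u^*\alpha)(v)=-\alpha([u,v])$. Its canonical quadratic form is the nondegenerate invariant symmetric bilinear form $\langle u+\alpha,v+\beta\rangle=\alpha(v)+\beta(u)$. $H^2$ denotes the second Chevalley–Eilenberg cohomology with trivial real coefficients; for a quadratic Lie algebra $(\mathfrak{k},\langle\cdot,\cdot\rangle)$ one has $H^2(\mathfrak{k})\cong(\mathrm{Der}(\mathfrak{k})\cap\mathfrak{so}(\mathfrak{k},\langle\cdot,\cdot\rangle))/\{\mathrm{ad}_u:u\in\mathfrak{k}\}$. *)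

theory Defs
  imports "HOL-Analysis.Analysis"
begin

(* A finite-dimensional real Lie algebra: the underlying space is a type of class
   euclidean_space (= finite-dimensional real vector space; the inner product is
   not used), with a bracket br. *)

definition lie_algebra :: "('a::real_vector \<Rightarrow> 'a \<Rightarrow> 'a) \<Rightarrow> bool" where
  "lie_algebra br \<longleftrightarrow> bilinear br \<and> (\<forall>x. br x x = 0) \<and>
     (\<forall>x y z. br x (br y z) + br y (br z x) + br z (br x y) = 0)"

definition lie_ideal :: "('a::real_vector \<Rightarrow> 'a \<Rightarrow> 'a) \<Rightarrow> 'a set \<Rightarrow> bool" where
  "lie_ideal br I \<longleftrightarrow> subspace I \<and> (\<forall>x y. y \<in> I \<longrightarrow> br x y \<in> I)"

definition simple_lie_algebra :: "('a::real_vector \<Rightarrow> 'a \<Rightarrow> 'a) \<Rightarrow> bool" where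
  "simple_lie_algebra br \<longleftrightarrow> lie_algebra br \<and> (\<exists>x y. br x y \<noteq> 0) \<and>
     (\<forall>I. lie_ideal br I \<longrightarrow> I = {0} \<or> I = UNIV)"

(* T^*g = g \<oplus> g^*, elements are pairs (u, \<alpha>) with \<alpha> a linear functional *)
type_synonym 'a tstar = "'a \<times> ('a \<Rightarrow> real)"

definition tstar_carrier :: "'a::real_vector tstar set" where
  "tstar_carrier = {(u, \<alpha>). linear \<alpha>}"

definition tadd :: "'a::real_vector tstar \<Rightarrow> 'a tstar \<Rightarrow> 'a tstar" where
  "tadd x y = (fst x + fst y, \<lambda>w. snd x w + snd y w)"

definition tscale :: "real \<Rightarrow> 'a::real_vector tstar \<Rightarrow> 'a tstar" where
  "tscale c x = (c *\<^sub>R fst x, \<lambda>w. c * snd x w)"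

(* [u+\<alpha>, v+\<beta>] = [u,v] + ad^*_u \<beta> - ad^*_v \<alpha>, with (ad^*_u \<alpha>)(w) = -\<alpha>([u,w]) *)
definition tbr :: "('a::real_vector \<Rightarrow> 'a \<Rightarrow> 'a) \<Rightarrow> 'a tstar \<Rightarrow> 'a tstar \<Rightarrow> 'a tstar" where
  "tbr br x y = (br (fst x) (fst y),
                 \<lambda>w. - snd y (br (fst x) w) + snd x (br (fst y) w))"

definition tform :: "'a::real_vector tstar \<Rightarrow> 'a tstar \<Rightarrow> real" where
  "tform x y = snd x (fst y) + snd y (fst x)"

definition tlinear :: "('a::real_vector tstar \<Rightarrow> 'b::real_vector) \<Rightarrow> bool" where
  "tlinear f \<longleftrightarrow> (\<forall>x\<in>tstar_carrier. \<forall>y\<in>tstar_carrier. f (tadd x y) = f x + f y) \<and>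
     (\<forall>c. \<forall>x\<in>tstar_carrier. f (tscale c x) = c *\<^sub>R f x)"

definition tstar_derivation ::
  "('a::real_vector \<Rightarrow> 'a \<Rightarrow> 'a) \<Rightarrow> ('a tstar \<Rightarrow> 'a tstar) \<Rightarrow> bool" where
  "tstar_derivation br D \<longleftrightarrow>
     (\<forall>x\<in>tstar_carrier. D x \<in> tstar_carrier) \<and>
     (\<forall>x\<in>tstar_carrier. \<forall>y\<in>tstar_carrier. D (tadd x y) = tadd (D x) (D y)) \<and>
     (\<forall>c. \<forall>x\<in>tstar_carrier. D (tscale c x) = tscale c (D x)) \<and>
     (\<forall>x\<in>tstar_carrier. \<forall>y\<in>tstar_carrier.
        D (tbr br x y) = tadd (tbr br (D x) y) (tbr br x (D y)))"

definition tstar_skew :: "('a::real_vector tstar \<Rightarrow> 'a tstar) \<Rightarrow> bool" where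
  "tstar_skew D \<longleftrightarrow>
     (\<forall>x\<in>tstar_carrier. \<forall>y\<in>tstar_carrier. tform (D x) y + tform x (D y) = 0)"

definition tstar_inner ::
  "('a::real_vector \<Rightarrow> 'a \<Rightarrow> 'a) \<Rightarrow> ('a tstar \<Rightarrow> 'a tstar) \<Rightarrow> bool" where
  "tstar_inner br D \<longleftrightarrow> (\<exists>z\<in>tstar_carrier. \<forall>x\<in>tstar_carrier. D x = tbr br z x)"

definition tstar_2cocycle ::
  "('a::real_vector \<Rightarrow> 'a \<Rightarrow> 'a) \<Rightarrow> ('a tstar \<Rightarrow> 'a tstar \<Rightarrow> real) \<Rightarrow> bool" where
  "tstar_2cocycle br \<omega> \<longleftrightarrow>
     (\<forall>x\<in>tstar_carrier. tlinear (\<lambda>y. \<omega> x y)) \<and>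
     (\<forall>y\<in>tstar_carrier. tlinear (\<lambda>x. \<omega> x y)) \<and>
     (\<forall>x\<in>tstar_carrier. \<omega> x x = 0) \<and>
     (\<forall>x\<in>tstar_carrier. \<forall>y\<in>tstar_carrier. \<forall>z\<in>tstar_carrier.
        \<omega> (tbr br x y) z + \<omega> (tbr br y z) x + \<omega> (tbr br z x) y = 0)"

definition tstar_2coboundary ::
  "('a::real_vector \<Rightarrow> 'a \<Rightarrow> 'a) \<Rightarrow> ('a tstar \<Rightarrow> 'a tstar \<Rightarrow> real) \<Rightarrow> bool" where
  "tstar_2coboundary br \<omega> \<longleftrightarrow>
     (\<exists>f :: 'a tstar \<Rightarrow> real. tlinear f \<and>
        (\<forall>x\<in>tstar_carrier. \<forall>y\<in>tstar_carrier. \<omega> x y = f (tbr br x y)))"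

definition H2_tstar_trivial :: "('a::real_vector \<Rightarrow> 'a \<Rightarrow> 'a) \<Rightarrow> bool" where
  "H2_tstar_trivial br \<longleftrightarrow> (\<forall>\<omega>. tstar_2cocycle br \<omega> \<longrightarrow> tstar_2coboundary br \<omega>)"

end

(* Write T for the cotangent extension of the simple algebra g.  Pairing with the canonical form
   turns a 2-cocycle into a skew derivation of T, and a skew derivation D splits into a derivation
   of g, a 1-cocycle g -> g*, an equivariant map P : g* -> g and a component determined by skewness.
   The image of P is an abelian ideal, hence 0.  The other two pieces are inner because the Killing
   form is nondegenerate.

   Nondegeneracy: if the Killing form vanishes, then tr (ad x o E) = 0 for every derivation E, since
   g is perfect.  Choose a complex polynomial q that takes the value cnj c, to high order, at the
   generalized eigenvalues c of ad x and at their pairwise sums.  Then q(ad x) is a derivation of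
   the complexification, and its real part E satisfies tr (ad x o E) = sum |c|^2, so ad x is
   nilpotent.  By Engel's theorem g then has nonzero centre, a contradiction. *)
theory Submission
  imports Defs "Jordan_Normal_Form.Schur_Decomposition" "HOL-Computational_Algebra.Field_as_Ring"
begin

section \<open>Traces of powers\<close>

text \<open>The eigenvalues of \<open>ad x\<close> need not be real, and a real simple algebra need
  not remain simple over the complex numbers. Simplicity is therefore only ever used over the reals,
  and complex scalars serve only to build the one real derivation \<open>E\<close>. Conjugation is
  the right function of the eigenvalues for two reasons: it is additive, which lets it define a
  derivation, and c * cnj c = |c|^2, so a vanishing trace forces all eigenvalues to vanish. The high
  order of contact is needed because \<open>ad x\<close> need not be diagonalizable: it makes q(ad
  x) the scalar cnj c on a whole generalized eigenspace. Equivariance alone cannot dispose of the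
  map g* -> g, since the Killing form makes g and g* isomorphic modules and nonzero equivariant maps
  do exist. What excludes them is that g* is abelian inside T.\<close>

definition tr :: "('a::euclidean_space \<Rightarrow> 'a) \<Rightarrow> real" where
  "tr f = (\<Sum>b\<in>Basis. f b \<bullet> b)"

lemma sum_diag_mult_commute:
  fixes X Y :: "'c::comm_semiring_0 mat"
  assumes "X \<in> carrier_mat n n" "Y \<in> carrier_mat n n"
  shows "(\<Sum>i<n. (X * Y) $$ (i,i)) = (\<Sum>i<n. (Y * X) $$ (i,i))"
proof -
  have *: "(\<Sum>i<n. (X * Y) $$ (i,i)) = (\<Sum>i<n. \<Sum>k<n. X $$ (i,k) * Y $$ (k,i))"
    if "X \<in> carrier_mat n n" "Y \<in> carrier_mat n n" for X Y :: "'c mat"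
    using that by (intro sum.cong refl) (auto simp: scalar_prod_def lessThan_atLeast0)
  show ?thesis
    unfolding *[OF assms] *[OF assms(2,1)] by (subst sum.swap) (simp add: mult.commute)
qed

lemma upper_triangular_mult:
  fixes X Y :: "'c::comm_semiring_1 mat"
  assumes "X \<in> carrier_mat n n" "Y \<in> carrier_mat n n"
    and "upper_triangular X" "upper_triangular Y"
  shows "upper_triangular (X * Y)"
    and "i < n \<Longrightarrow> (X * Y) $$ (i,i) = X $$ (i,i) * Y $$ (i,i)"
proof -
  have entry: "(X * Y) $$ (i,j) = (\<Sum>k<n. X $$ (i,k) * Y $$ (k,j))" if "i < n" "j < n" for i j
    using assms(1,2) that by (auto simp: scalar_prod_def lessThan_atLeast0)
  have z: "X $$ (i,k) * Y $$ (k,j) = 0" if "i < n" "j < n" "k < n" "k < i \<or> j < k" for i j k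
    using that assms upper_triangularD[OF assms(3), of k i] upper_triangularD[OF assms(4), of j k]
    by auto
  show "upper_triangular (X * Y)"
  proof (rule upper_triangularI)
    fix i j assume "j < i" "i < dim_row (X * Y)"
    then show "(X * Y) $$ (i,j) = 0"
      using assms(1) by (subst entry) (auto intro!: sum.neutral z)
  qed
  show "(X * Y) $$ (i,i) = X $$ (i,i) * Y $$ (i,i)" if "i < n"
  proof -
    have "(X * Y) $$ (i,i) = (\<Sum>k\<in>{i}. X $$ (i,k) * Y $$ (k,i))"
      unfolding entry[OF that that]
      by (rule sum.mono_neutral_right) (use that in \<open>auto intro!: z\<close>)
    then show ?thesis by simp
  qed
qed

lemma upper_triangular_pow:
  fixes B :: "'c::comm_semiring_1 mat"
  assumes B: "B \<in> carrier_mat n n" "upper_triangular B"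
  shows "upper_triangular (B ^\<^sub>m k)"
    and "i < n \<Longrightarrow> (B ^\<^sub>m k) $$ (i,i) = (B $$ (i,i)) ^ k"
proof -
  have "upper_triangular (B ^\<^sub>m k) \<and> (\<forall>i<n. (B ^\<^sub>m k) $$ (i,i) = (B $$ (i,i)) ^ k)"
  proof (induction k)
    case 0
    then show ?case using B by auto
  next
    case (Suc k)
    have c: "B ^\<^sub>m k \<in> carrier_mat n n" using B by simp
    show ?case
      using upper_triangular_mult[OF c B(1) _ B(2)] Suc by (simp add: mult.commute)
  qed
  then show "upper_triangular (B ^\<^sub>m k)"
    and "i < n \<Longrightarrow> (B ^\<^sub>m k) $$ (i,i) = (B $$ (i,i)) ^ k" by auto
qed

lemma strictly_upper_triangular_nilpotent:
  fixes B :: "'c::comm_semiring_1 mat"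
  assumes B: "B \<in> carrier_mat n n" "upper_triangular B" and d: "\<And>i. i < n \<Longrightarrow> B $$ (i,i) = 0"
  shows "B ^\<^sub>m n = 0\<^sub>m n n"
proof -
  \<comment> \<open>Each further factor shifts the zero band by one diagonal; at k = n the band
    covers the whole matrix.\<close>
  have "\<forall>i<n. \<forall>j<n. j < i + k \<longrightarrow> (B ^\<^sub>m k) $$ (i,j) = 0" for k
  proof (induction k)
    case 0
    then show ?case using B by auto
  next
    case (Suc k)
    have c: "B ^\<^sub>m k \<in> carrier_mat n n" using B by simp
    show ?case
    proof (intro allI impI)
      fix i j assume ij: "i < n" "j < n" "j < i + Suc k"
      have "(B ^\<^sub>m k) $$ (i,l) * B $$ (l,j) = 0" if "l < n" for l
      proof (cases "l < i + k")
        case True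
        then show ?thesis using Suc ij that by simp
      next
        case False
        then have "j \<le> l" using ij by simp
        then show ?thesis
          using upper_triangularD[OF B(2), of j l] d[of l] that B(1) by (cases "j = l") auto
      qed
      then show "(B ^\<^sub>m Suc k) $$ (i,j) = 0"
        using B c ij by (auto simp: scalar_prod_def intro!: sum.neutral)
    qed
  qed
  from this[of n] show ?thesis using B by (intro eq_matI) auto
qed

lemma linear_funpow:
  fixes d :: "'a::real_vector \<Rightarrow> 'a"
  assumes "linear d"
  shows "linear (d ^^ k)"
proof (induction k)
  case 0
  show ?case using linear_ident by (simp add: id_def)
next
  case (Suc k)
  show ?case
    unfolding funpow.simps by (rule linear_compose[OF Suc assms])
qed

text \<open>\<open>es\<close> is the diagonal of a complex Schur form of the matrix of
  \<open>d\<close>, a list so that multiplicities survive. Similarity preserves the traces of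
  powers, and powers of a triangular matrix have the powers of the diagonal on their diagonal. If
  that diagonal is zero, the form is strictly triangular, hence nilpotent.\<close>

lemma trace_powers_eq_power_sums:
  fixes d :: "'a::euclidean_space \<Rightarrow> 'a"
  assumes "linear d"
  obtains es :: "complex list"
  where "\<And>k. complex_of_real (tr (d ^^ k)) = (\<Sum>e\<leftarrow>es. e ^ k)"
    and "\<forall>e\<in>set es. e = 0 \<Longrightarrow> d ^^ DIM('a) = (\<lambda>_. 0)"
proof -
  define n where "n = DIM('a)"
  obtain h where h: "bij_betw h {0..<n} (Basis :: 'a set)"
    unfolding n_def using ex_bij_betw_nat_finite[OF finite_Basis] by blast
  define M where "M f = Matrix.mat n n (\<lambda>(i,j). complex_of_real (f (h j) \<bullet> h i))" for f :: "'a \<Rightarrow> 'a"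
  have M_carrier [simp]: "M f \<in> carrier_mat n n" for f by (simp add: M_def)
  have sum_h: "(\<Sum>l<n. g (h l)) = sum g Basis" for g :: "'a \<Rightarrow> real"
    using sum.reindex_bij_betw[OF h] by (simp add: lessThan_atLeast0)
  have hB: "h i \<in> Basis" if "i < n" for i
    using h that by (auto simp: bij_betw_def)
  have M_comp: "M (f \<circ> g) = M f * M g" if "linear f" for f g
  proof (rule eq_matI)
    fix i j assume "i < dim_row (M f * M g)" "j < dim_col (M f * M g)"
    then have ij: "i < n" "j < n" by (auto simp: M_def)
    have "f (g (h j)) = f (\<Sum>b\<in>Basis. (g (h j) \<bullet> b) *\<^sub>R b)"
      by (simp add: euclidean_representation)
    also have "\<dots> = (\<Sum>b\<in>Basis. (g (h j) \<bullet> b) *\<^sub>R f b)"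
      using that by (simp add: linear_sum linear_scale)
    finally have "f (g (h j)) \<bullet> h i = (\<Sum>b\<in>Basis. (g (h j) \<bullet> b) * (f b \<bullet> h i))"
      by (simp add: inner_sum_left)
    also have "\<dots> = (\<Sum>l<n. (f (h l) \<bullet> h i) * (g (h j) \<bullet> h l))"
      by (simp add: sum_h[symmetric] mult.commute)
    finally show "M (f \<circ> g) $$ (i,j) = (M f * M g) $$ (i,j)"
      using ij by (simp add: M_def scalar_prod_def lessThan_atLeast0)
  qed (auto simp: M_def)
  have M_id: "M id = 1\<^sub>m n"
    using h by (intro eq_matI) (auto simp: M_def hB inner_Basis bij_betw_def inj_on_eq_iff)
  have lin_pow: "linear (d ^^ k)" for k
    by (rule linear_funpow[OF assms])
  have M_pow: "M (d ^^ k) = M d ^\<^sub>m k" for k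
  proof (induction k)
    case (Suc k)
    then show ?case using M_comp[OF lin_pow, of k d] by (simp only: funpow_Suc_right pow_mat.simps)
  next
    case 0
    have "dim_row (M d) = n" by (simp add: M_def)
    then show ?case by (simp only: funpow.simps pow_mat.simps M_id)
  qed
  obtain es where "char_poly (M d) = (\<Prod>e\<leftarrow>es. [:- e, 1:])"
    using char_poly_factorized[OF M_carrier] by blast
  from schur_decomposition_exists[OF M_carrier this]
  obtain B where B: "B \<in> carrier_mat n n" "upper_triangular B" and "similar_mat (M d) B" by blast
  then obtain P Q where PQ: "similar_mat_wit (M d) B P Q" by (auto simp: similar_mat_def)
  note wit = similar_mat_witD2[OF M_carrier PQ]
  have carrier: "P \<in> carrier_mat n n" "Q \<in> carrier_mat n n" "B ^\<^sub>m k \<in> carrier_mat n n" for k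
    using wit B by auto
  have M_powB: "M (d ^^ k) = P * B ^\<^sub>m k * Q" for k
    unfolding M_pow by (rule similar_mat_wit_pow_id[OF PQ])
  define es' where "es' = map (\<lambda>i. B $$ (i,i)) [0..<n]"
  have "complex_of_real (tr (d ^^ k)) = (\<Sum>e\<leftarrow>es'. e ^ k)" for k
  proof -
    have "complex_of_real (tr (d ^^ k)) = (\<Sum>i<n. M (d ^^ k) $$ (i,i))"
      by (simp add: tr_def sum_h[symmetric] M_def)
    also have "\<dots> = (\<Sum>i<n. (P * (B ^\<^sub>m k * Q)) $$ (i,i))"
      unfolding M_powB using carrier by (simp add: assoc_mult_mat[of _ n n _ n _ n])
    also have "\<dots> = (\<Sum>i<n. (B ^\<^sub>m k * Q * P) $$ (i,i))"
      by (rule sum_diag_mult_commute[OF carrier(1) mult_carrier_mat[OF carrier(3,2)]])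
    also have "B ^\<^sub>m k * Q * P = B ^\<^sub>m k"
      using carrier wit by (simp add: assoc_mult_mat[of _ n n _ n _ n])
    finally show ?thesis
      by (simp add: upper_triangular_pow[OF B] es'_def o_def sum_list_sum_nth lessThan_atLeast0)
  qed
  moreover have "d ^^ DIM('a) = (\<lambda>_. 0)" if "\<forall>e\<in>set es'. e = 0"
  proof -
    have "B ^\<^sub>m n = 0\<^sub>m n n"
      using that by (intro strictly_upper_triangular_nilpotent[OF B]) (auto simp: es'_def)
    then have M0: "M (d ^^ n) = 0\<^sub>m n n"
      unfolding M_powB using carrier by simp
    have "(d ^^ n) b = 0" if "b \<in> Basis" for b
    proof (rule euclidean_eqI)
      fix c :: 'a assume "c \<in> Basis"
      then have "c \<in> h ` {0..<n}" "b \<in> h ` {0..<n}"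
        using h \<open>b \<in> Basis\<close> by (simp_all add: bij_betw_def)
      then obtain i j where ij: "i < n" "j < n" "c = h i" "b = h j" by auto
      have "M (d ^^ n) $$ (i,j) = 0" using ij M0 by simp
      then show "(d ^^ n) b \<bullet> c = 0 \<bullet> c" using ij by (simp add: M_def)
    qed
    then have "d ^^ n = (\<lambda>_. 0)"
      by (intro linear_eq_stdbasis lin_pow linear_zero) auto
    then show ?thesis by (simp add: n_def)
  qed
  ultimately show thesis by (rule that)
qed

section \<open>Polynomials acting on the complexification\<close>

text \<open>The complexification of \<open>V\<close> is modelled as \<open>V \<times> V\<close>, the pair \<open>(u, v)\<close> standing for \<open>u + i v\<close>.\<close>

definition cscale :: "complex \<Rightarrow> 'a::real_vector \<times> 'a \<Rightarrow> 'a \<times> 'a" where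
  "cscale c w = (Re c *\<^sub>R fst w - Im c *\<^sub>R snd w, Re c *\<^sub>R snd w + Im c *\<^sub>R fst w)"

lemma cscale_0 [simp]: "cscale 0 w = 0" and cscale_1 [simp]: "cscale 1 w = w"
  and cscale_zero [simp]: "cscale c 0 = 0"
  by (simp_all add: cscale_def zero_prod_def)

lemma cscale_of_real: "cscale (complex_of_real r) w = r *\<^sub>R w"
  by (simp add: cscale_def scaleR_prod_def)

lemma cscale_add_left: "cscale (a + b) w = cscale a w + cscale b w"
  and cscale_add_right: "cscale a (v + w) = cscale a v + cscale a w"
  and cscale_minus_left: "cscale (- a) w = - cscale a w"
  by (simp_all add: cscale_def algebra_simps)

lemma cscale_cscale: "cscale a (cscale b w) = cscale (a * b) w"
  by (simp add: cscale_def algebra_simps)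

lemma linear_cscale: "linear (cscale c)"
  by (rule linearI) (simp_all add: cscale_def algebra_simps)

lemma map_prod_cscale:
  assumes "linear d"
  shows "map_prod d d (cscale c w) = cscale c (map_prod d d w)"
  using assms by (cases w) (simp add: cscale_def linear_add linear_diff linear_scale)

lemma linear_map_prod_same: "linear d \<Longrightarrow> linear (map_prod d d)"
  by (rule linearI) (auto simp: linear_add linear_scale)

definition papp :: "('a::real_vector \<Rightarrow> 'a) \<Rightarrow> complex poly \<Rightarrow> 'a \<times> 'a \<Rightarrow> 'a \<times> 'a" where
  "papp d p w = (\<Sum>k\<le>degree p. cscale (coeff p k) (map_prod (d ^^ k) (d ^^ k) w))"

lemma papp_0 [simp]: "papp d 0 w = 0"
  by (simp add: papp_def)

text \<open>Horner's rule. The algebra of \<open>papp\<close>, in particular multiplicativity,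
  follows from it by induction on polynomials, without any bookkeeping of degrees.\<close>

lemma papp_pCons:
  assumes "linear d"
  shows "papp d (pCons a p) w = cscale a w + map_prod d d (papp d p w)"
proof (cases "p = 0")
  case True
  have "map_prod d d 0 = (0 :: 'a \<times> 'a)"
    using linear_0[OF linear_map_prod_same[OF assms]] .
  with True show ?thesis by (simp add: papp_def id_def[symmetric] prod.map_id0)
next
  case False
  have "map_prod d d (papp d p w) =
      (\<Sum>k\<le>degree p. cscale (coeff p k) (map_prod (d ^^ Suc k) (d ^^ Suc k) w))"
    unfolding papp_def linear_sum[OF linear_map_prod_same[OF assms]]
    by (cases w) (simp add: map_prod_cscale[OF assms])
  then show ?thesis
    using False by (simp add: papp_def sum.atMost_Suc_shift id_def[symmetric] prod.map_id0 del: funpow.simps(2) sum.atMost_Suc)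
qed

lemma papp_add:
  assumes "linear d"
  shows "papp d (p + q) w = papp d p w + papp d q w"
  by (induction p q rule: poly_induct2)
    (simp_all add: papp_pCons[OF assms] cscale_add_left linear_add[OF linear_map_prod_same[OF assms]])

lemma papp_smult:
  assumes "linear d"
  shows "papp d (Polynomial.smult a p) w = cscale a (papp d p w)"
  by (induction p)
    (simp_all add: papp_pCons[OF assms] cscale_cscale cscale_add_right map_prod_cscale[OF assms])

lemma papp_mult:
  assumes "linear d"
  shows "papp d (p * q) w = papp d p (papp d q w)"
  by (induction p)
    (simp_all add: papp_pCons[OF assms] papp_add[OF assms] papp_smult[OF assms])

lemma papp_const: "linear d \<Longrightarrow> papp d [:c:] w = cscale c w"
  by (simp add: papp_def id_def[symmetric] prod.map_id0)

lemma papp_1: "linear d \<Longrightarrow> papp d 1 w = w"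
  by (simp add: one_pCons papp_const)

lemma papp_monom:
  "papp d (monom c k) w = cscale c (map_prod (d ^^ k) (d ^^ k) w)"
proof (cases "c = 0")
  case False
  have "papp d (monom c k) w = (\<Sum>i\<in>{k}. cscale (coeff (monom c k) i) (map_prod (d ^^ i) (d ^^ i) w))"
    unfolding papp_def using False
    by (intro sum.mono_neutral_right) (auto simp: degree_monom_eq)
  then show ?thesis by simp
qed simp

lemma papp_sum: "linear d \<Longrightarrow> papp d (sum f S) w = (\<Sum>i\<in>S. papp d (f i) w)"
  by (induction S rule: infinite_finite_induct) (auto simp: papp_add)

lemma linear_papp:
  assumes "linear d"
  shows "linear (papp d p)"
proof (induction p)
  case (pCons a p)
  show ?case
    using linear_compose_add[OF linear_cscale[of a] linear_compose[OF pCons(2) linear_map_prod_same[OF assms]]]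
    by (simp add: papp_pCons[OF assms] o_def)
qed (simp add: linear_zero)

lemma papp_linear_factor:
  "linear d \<Longrightarrow> papp d [:- c, 1:] w = map_prod d d w - cscale c w"
  by (simp add: papp_pCons papp_const cscale_minus_left linear_0[OF linear_map_prod_same])

text \<open>The exponent stays a parameter because brackets add exponents, and the interpolation
  later needs one explicit bound for all of them.\<close>

definition gen_eigenspace :: "('a::real_vector \<Rightarrow> 'a) \<Rightarrow> complex \<Rightarrow> nat \<Rightarrow> ('a \<times> 'a) set" where
  "gen_eigenspace d c N = {w. papp d ([:- c, 1:] ^ N) w = 0}"

lemma papp_dvd_eq_0:
  assumes "linear d" "p dvd q" "papp d p w = 0"
  shows "papp d q w = 0"
proof -
  obtain r where "q = p * r" using assms(2) by (rule dvdE)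
  then have "q = r * p" by (simp add: mult.commute)
  then show ?thesis
    using assms(1,3) by (simp add: papp_mult linear_0[OF linear_papp])
qed

lemma gen_eigenspace_mono:
  "linear d \<Longrightarrow> M \<le> N \<Longrightarrow> gen_eigenspace d c M \<subseteq> gen_eigenspace d c N"
  unfolding gen_eigenspace_def by (auto intro: papp_dvd_eq_0 le_imp_power_dvd)

section \<open>Primary decomposition and interpolation by Bezout identities\<close>

lemma coprime_bezout_poly:
  fixes p q :: "complex poly"
  assumes "coprime p q"
  obtains a b where "a * p + b * q = 1"
  using bezout_coefficients_fst_snd[of p q] assms by (metis coprime_imp_gcd_eq_1)

text \<open>Division with remainder: a common divisor of X - c and g also divides the nonzero
  constant g(c).\<close>

lemma coprime_linear_factor:
  fixes g :: "complex poly"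
  assumes "poly g c \<noteq> 0"
  shows "coprime ([:- c, 1:] ^ k) g"
proof -
  have "coprime [:- c, 1:] g"
  proof (rule coprimeI)
    fix h assume h: "h dvd [:- c, 1:]" "h dvd g"
    have "g - [:- c, 1:] * synthetic_div g c = [:poly g c:]"
      using synthetic_div_correct'[of c g] by (metis add_diff_cancel_left')
    moreover have "h dvd g - [:- c, 1:] * synthetic_div g c"
      using h by (intro dvd_diff dvd_mult2)
    moreover have "[:poly g c:] dvd 1"
      using assms by (simp add: is_unit_const_poly_iff dvd_field_iff)
    ultimately show "h dvd 1" by (metis dvd_trans)
  qed
  then show ?thesis by simp
qed

text \<open>Primary decomposition of a single vector. Write p = (X - c)^k * g with the full
  multiplicity k, and 1 = a (X - c)^k + b g. The first summand of w is killed by g, which has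
  smaller degree; the second is killed by (X - c)^k. \<open>N\<close> has to bound every
  multiplicity, which \<open>degree p\<close> does.\<close>

lemma in_span_gen_eigenspaces:
  assumes "linear d" "p \<noteq> 0" "papp d p w = 0" "degree p \<le> N"
  shows "w \<in> span (\<Union>c\<in>{c. poly p c = 0}. gen_eigenspace d c N)"
  using assms(2-)
proof (induction "degree p" arbitrary: p w rule: less_induct)
  case less
  note lin = linear_papp[OF assms(1)]
  show ?case
  proof (cases "degree p = 0")
    case True
    then obtain c where c: "p = [:c:]" "c \<noteq> 0" using less.prems by (auto elim: degree_eq_zeroE)
    then have "cscale (inverse c) (cscale c w) = 0"
      using less.prems assms(1) by (simp add: papp_const)
    then have "w = 0" using c by (simp add: cscale_cscale)
    then show ?thesis by (simp add: span_zero)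
  next
    case False
    then obtain c where c: "poly p c = 0"
      using fundamental_theorem_of_algebra[of p] by (auto simp: constant_degree)
    define k where "k = Polynomial.order c p"
    obtain g where g: "p = [:- c, 1:] ^ k * g" "\<not> [:- c, 1:] dvd g"
      using order_decomp[OF less.prems(1), of c] k_def by blast
    have "k \<noteq> 0" using c less.prems(1) by (simp add: k_def order_root)
    have g0: "g \<noteq> 0" "poly g c \<noteq> 0" using g by (auto simp: poly_eq_0_iff_dvd)
    have deg: "degree p = k + degree g"
      using g0 by (simp add: g(1) degree_mult_eq degree_power_eq)
    obtain a b where ab: "a * [:- c, 1:] ^ k + b * g = 1"
      using coprime_bezout_poly[OF coprime_linear_factor[OF g0(2)]] .
    define w1 w2 where "w1 = papp d (a * [:- c, 1:] ^ k) w" and "w2 = papp d (b * g) w"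
    have w: "w = w1 + w2"
      using ab papp_add[OF assms(1)] papp_1[OF assms(1)] by (simp add: w1_def w2_def flip: papp_add[OF assms(1)])
    have "papp d g w1 = 0"
    proof -
      have "papp d g w1 = papp d (g * (a * [:- c, 1:] ^ k)) w"
        by (simp only: w1_def papp_mult[OF assms(1)])
      also have "\<dots> = 0"
        by (rule papp_dvd_eq_0[OF assms(1) _ less.prems(2)]) (simp add: g(1))
      finally show ?thesis .
    qed
    then have "w1 \<in> span (\<Union>c\<in>{c. poly g c = 0}. gen_eigenspace d c N)"
      using less.hyps[of g w1] g0 deg \<open>k \<noteq> 0\<close> less.prems by auto
    moreover have "(\<Union>c\<in>{c. poly g c = 0}. gen_eigenspace d c N) \<subseteq> (\<Union>c\<in>{c. poly p c = 0}. gen_eigenspace d c N)"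
      by (auto simp: g(1))
    ultimately have 1: "w1 \<in> span (\<Union>c\<in>{c. poly p c = 0}. gen_eigenspace d c N)"
      using span_mono by blast
    have "papp d ([:- c, 1:] ^ k) w2 = 0"
    proof -
      have "papp d ([:- c, 1:] ^ k) w2 = papp d ([:- c, 1:] ^ k * (b * g)) w"
        by (simp only: w2_def papp_mult[OF assms(1)])
      also have "\<dots> = 0"
        by (rule papp_dvd_eq_0[OF assms(1) _ less.prems(2)]) (simp add: g(1))
      finally show ?thesis .
    qed
    then have "w2 \<in> gen_eigenspace d c N"
      using gen_eigenspace_mono[OF assms(1), of k N c] deg less.prems(3)
      by (auto simp: gen_eigenspace_def)
    with c have "w2 \<in> span (\<Union>c\<in>{c. poly p c = 0}. gen_eigenspace d c N)"
      by (intro span_base) auto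
    with 1 show ?thesis unfolding w by (rule span_add)
  qed
qed

lemma exists_annihilating_poly:
  fixes d :: "'a::euclidean_space \<Rightarrow> 'a"
  assumes "linear d"
  obtains p where "p \<noteq> 0" "papp d p w = 0"
proof -
  define f where "f k = map_prod (d ^^ k) (d ^^ k) w" for k
  \<comment> \<open>The iterates f 0, ..., f m are one more than the dimension. Dependence concerns
    the set of values, so a repetition f i = f j is treated separately; there X^i - X^j annihilates
    w.\<close>
  define m where "m = DIM('a \<times> 'a)"
  show thesis
  proof (cases "inj_on f {..m}")
    case False
    then obtain i j where ij: "i \<noteq> j" "f i = f j" by (auto simp: inj_on_def)
    have "papp d (monom 1 i + monom (- 1) j) w = 0"
      using ij by (simp add: papp_add[OF assms] papp_monom f_def cscale_minus_left)
    moreover have "monom 1 i + monom (- 1) j \<noteq> (0 :: complex poly)"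
    proof
      assume "monom 1 i + monom (- 1) j = (0 :: complex poly)"
      from arg_cong[OF this, of "\<lambda>p. coeff p i"] ij show False by simp
    qed
    ultimately show thesis by (rule that[rotated])
  next
    case True
    then have "dependent (f ` {..m})"
      by (intro dependent_biggerset) (auto simp: card_image m_def)
    then obtain u where u: "\<exists>v\<in>f ` {..m}. u v \<noteq> 0" "(\<Sum>v\<in>f ` {..m}. u v *\<^sub>R v) = 0"
      by (subst (asm) dependent_finite) auto
    define p where "p = (\<Sum>k\<le>m. monom (complex_of_real (u (f k))) k)"
    have "papp d p w = (\<Sum>k\<le>m. u (f k) *\<^sub>R f k)"
      by (simp add: p_def papp_sum[OF assms] papp_monom cscale_of_real f_def)
    also have "\<dots> = 0" using u(2) True by (simp add: sum.reindex)
    finally have "papp d p w = 0" .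
    moreover obtain k where k: "k \<le> m" "u (f k) \<noteq> 0" using u(1) by auto
    have "coeff p k = (\<Sum>i\<in>{k}. complex_of_real (u (f i)))"
      unfolding p_def coeff_sum using k(1)
      by (subst sum.mono_neutral_right[of "{..m}" "{k}"]) auto
    then have "p \<noteq> 0" using k by auto
    ultimately show thesis by (rule that[rotated])
  qed
qed

text \<open>Every basis vector has its own annihilating polynomial; \<open>S\<close> collects all
  their roots and \<open>N\<close> is the largest of their degrees.\<close>

lemma gen_eigenspaces_span:
  fixes d :: "'a::euclidean_space \<Rightarrow> 'a"
  assumes "linear d"
  obtains S N where "finite S" "span (\<Union>c\<in>S. gen_eigenspace d c N) = UNIV"
proof -
  have "\<exists>p. p \<noteq> 0 \<and> papp d p b = 0" for b :: "'a \<times> 'a"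
    using exists_annihilating_poly[OF assms] by metis
  then obtain P where P: "\<And>b. P b \<noteq> 0" "\<And>b :: 'a \<times> 'a. papp d (P b) b = 0" by metis
  define S where "S = (\<Union>b\<in>(Basis :: ('a \<times> 'a) set). {c. poly (P b) c = 0})"
  define N where "N = Max (degree ` P ` (Basis :: ('a \<times> 'a) set))"
  have "finite S" unfolding S_def using P by (auto intro!: poly_roots_finite)
  moreover have "b \<in> span (\<Union>c\<in>S. gen_eigenspace d c N)" if "b \<in> Basis" for b :: "'a \<times> 'a"
  proof -
    have "degree (P b) \<le> N" unfolding N_def using that by (intro Max_ge) auto
    from in_span_gen_eigenspaces[OF assms P(1) P(2) this]
    show ?thesis
      by (rule subsetD[OF span_mono, rotated]) (use that in \<open>auto simp: S_def\<close>)
  qed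
  then have "span Basis \<subseteq> span (\<Union>c\<in>S. gen_eigenspace d c N)"
    by (intro span_minimal) auto
  then have "span (\<Union>c\<in>S. gen_eigenspace d c N) = UNIV" by auto
  ultimately show thesis by (rule that)
qed

text \<open>The Chinese remainder theorem for the pairwise coprime moduli (X - c)^M, solved one
  point at a time.\<close>

lemma flat_interpolation:
  fixes S :: "complex set"
  assumes "finite S"
  shows "\<exists>q. \<forall>c\<in>S. [:- c, 1:] ^ M dvd q - [:f c:]"
  using assms
proof (induction S)
  case (insert c S)
  then obtain q where q: "\<And>x. x \<in> S \<Longrightarrow> [:- x, 1:] ^ M dvd q - [:f x:]" by blast
  define P where "P = (\<Prod>x\<in>S. [:- x, 1:] ^ M)"
  have "poly P c \<noteq> 0" using insert by (auto simp: P_def poly_prod)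
  from coprime_bezout_poly[OF coprime_linear_factor[OF this]]
  obtain a b where ab: "a * [:- c, 1:] ^ M + b * P = 1" .
  \<comment> \<open>The correction is a multiple of \<open>P\<close>, so it respects the congruences
    at the old points; modulo (X - c)^M the factor b * P is 1, so it replaces q by the constant f
    c.\<close>
  define r where "r = q + P * (b * ([:f c:] - q))"
  have "r - [:f c:] = (q - [:f c:]) * (1 - b * P)"
    by (simp add: r_def algebra_simps)
  also have "1 - b * P = a * [:- c, 1:] ^ M" using ab by (simp add: algebra_simps)
  finally have "[:- c, 1:] ^ M dvd r - [:f c:]" by simp
  moreover have "[:- x, 1:] ^ M dvd r - [:f x:]" if "x \<in> S" for x
  proof -
    have "[:- x, 1:] ^ M dvd P" unfolding P_def using that insert(1) by (intro dvd_prodI)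
    then have "[:- x, 1:] ^ M dvd (q - [:f x:]) + P * (b * ([:f c:] - q))"
      using q[OF that] by (intro dvd_add) auto
    then show ?thesis by (simp add: r_def algebra_simps)
  qed
  ultimately show ?case by blast
qed simp

text \<open>The complex-bilinear extension of \<open>br\<close>, with real and imaginary parts
  written out.\<close>

definition cbr :: "('a::real_vector \<Rightarrow> 'a \<Rightarrow> 'a) \<Rightarrow> 'a \<times> 'a \<Rightarrow> 'a \<times> 'a \<Rightarrow> 'a \<times> 'a" where
  "cbr br x y = (br (fst x) (fst y) - br (snd x) (snd y), br (fst x) (snd y) + br (snd x) (fst y))"

lemma bilinear_cbr: "bilinear br \<Longrightarrow> bilinear (cbr br)"
  unfolding bilinear_def[of "cbr br"]
  by (auto intro!: linearI simp: cbr_def bilinear_ladd bilinear_radd bilinear_lmul bilinear_rmul algebra_simps)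

lemma cbr_cscale:
  assumes "bilinear br"
  shows "cbr br (cscale c x) y = cscale c (cbr br x y)"
    and "cbr br x (cscale c y) = cscale c (cbr br x y)"
  using assms
  by (simp_all add: cbr_def cscale_def bilinear_ladd bilinear_radd bilinear_lmul bilinear_rmul
      bilinear_lsub bilinear_rsub algebra_simps)

lemma cbr_derivation:
  assumes "bilinear br" "linear d" "\<And>x y. d (br x y) = br (d x) y + br x (d y)"
  shows "map_prod d d (cbr br x y) = cbr br (map_prod d d x) y + cbr br x (map_prod d d y)"
  using assms by (cases x; cases y) (simp add: cbr_def linear_add linear_diff)

text \<open>By the Leibniz rule, d - (a + b) applied to [x, y] is [(d - a) x, y] + [x, (d - b) y],
  and each term lowers one exponent. The bound i + j is generous, but it makes the case of a zero
  exponent trivial: then x or y is 0.\<close>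

lemma cbr_gen_eigenspace:
  assumes "bilinear br" "linear d" "\<And>x y. d (br x y) = br (d x) y + br x (d y)"
    and "x \<in> gen_eigenspace d a i" "y \<in> gen_eigenspace d b j"
  shows "cbr br x y \<in> gen_eigenspace d (a + b) (i + j)"
  using assms(4-)
proof (induction "i + j" arbitrary: i j x y)
  case 0
  then show ?case
    using assms by (simp add: gen_eigenspace_def papp_1 bilinear_lzero[OF bilinear_cbr])
next
  case (Suc n)
  let ?L = "\<lambda>c. papp d [:- c, 1:]"
  note bil = bilinear_cbr[OF assms(1)]
  have Suc_iff: "w \<in> gen_eigenspace d c (Suc k) \<longleftrightarrow> ?L c w \<in> gen_eigenspace d c k" for w c k
    unfolding gen_eigenspace_def
    by (simp only: power_Suc2 papp_mult[OF assms(2)] mem_Collect_eq)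
  have zero: "w \<in> gen_eigenspace d c 0 \<longleftrightarrow> w = 0" for w c
    by (simp add: gen_eigenspace_def papp_1[OF assms(2)])
  have zero_in: "0 \<in> gen_eigenspace d c k" for c k
    by (simp add: gen_eigenspace_def linear_0[OF linear_papp[OF assms(2)]])
  have add_in: "v + w \<in> gen_eigenspace d c k"
    if "v \<in> gen_eigenspace d c k" "w \<in> gen_eigenspace d c k" for v w c k
    using that by (simp add: gen_eigenspace_def linear_add[OF linear_papp[OF assms(2)]])
  have leib: "?L (a + b) (cbr br x y) = cbr br (?L a x) y + cbr br x (?L b y)"
    unfolding papp_linear_factor[OF assms(2)]
    by (simp add: cbr_derivation[OF assms(1-3)]
        bilinear_lsub[OF bil] bilinear_rsub[OF bil] cbr_cscale[OF assms(1)] cscale_add_left)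
  show ?case
  proof (cases "i = 0 \<or> j = 0")
    case True
    then have "cbr br x y = 0"
    proof
      assume "i = 0"
      then have "x = 0" using Suc.prems(1) zero by blast
      then show ?thesis by (simp add: bilinear_lzero[OF bil])
    next
      assume "j = 0"
      then have "y = 0" using Suc.prems(2) zero by blast
      then show ?thesis by (simp add: bilinear_rzero[OF bil])
    qed
    then show ?thesis by (simp add: zero_in)
  next
    case False
    then obtain i' j' where i: "i = Suc i'" and j: "j = Suc j'" by (metis not0_implies_Suc)
    have "cbr br (?L a x) y \<in> gen_eigenspace d (a + b) (i' + j)"
      using Suc i by (intro Suc.hyps) (auto simp: Suc_iff)
    moreover have "cbr br x (?L b y) \<in> gen_eigenspace d (a + b) (i + j')"
      using Suc j by (intro Suc.hyps) (auto simp: Suc_iff)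
    ultimately have "?L (a + b) (cbr br x y) \<in> gen_eigenspace d (a + b) n"
      unfolding leib using Suc i j by (intro add_in) auto
    then show ?thesis using Suc(2) Suc_iff by metis
  qed
qed

text \<open>On generalized eigenspaces for a and b the Leibniz rule for q(d) reduces to cnj (a + b)
  = cnj a + cnj b; these spaces span, so bilinearity extends the rule to all pairs.\<close>

lemma derivation_interpolating_cnj:
  fixes d :: "'a::euclidean_space \<Rightarrow> 'a"
  assumes "bilinear br" "linear d" "\<And>x y. d (br x y) = br (d x) y + br x (d y)" and "finite T"
  obtains q where "\<And>c. c \<in> T \<Longrightarrow> poly q c = cnj c"
    and "\<And>x y. papp d q (cbr br x y) = cbr br (papp d q x) y + cbr br x (papp d q y)"
proof -
  obtain S N where S: "finite S" "span (\<Union>c\<in>S. gen_eigenspace d c N) = UNIV"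
    using gen_eigenspaces_span[OF assms(2)] .
  \<comment> \<open>\<open>S\<close> and its sums serve the Leibniz rule. \<open>T\<close> is added
    because the trace computation prescribes values at a list of numbers whose relation to
    \<open>S\<close> is never established.\<close>
  define R where "R = T \<union> S \<union> (\<lambda>(a,b). a + b) ` (S \<times> S)"
  have "finite R" using S assms(4) by (simp add: R_def)
  \<comment> \<open>Brackets of elements of exponent \<open>N\<close> have exponent
    \<open>N + N\<close>; the \<open>Suc\<close> keeps the power positive even for N = 0, so that
    the congruence determines the value of q at the point.\<close>
  from flat_interpolation[OF this, of "Suc (N + N)" cnj]
  obtain q where q: "\<And>c. c \<in> R \<Longrightarrow> [:- c, 1:] ^ Suc (N + N) dvd q - [:cnj c:]" by blast
  have act: "papp d q w = cscale (cnj c) w" if "c \<in> R" "w \<in> gen_eigenspace d c (N + N)" for c w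
  proof -
    have "w \<in> gen_eigenspace d c (Suc (N + N))"
      using that gen_eigenspace_mono[OF assms(2)] by (meson le_SucI order_refl subsetD)
    then have "papp d (q - [:cnj c:]) w = 0"
      unfolding gen_eigenspace_def using papp_dvd_eq_0[OF assms(2) q[OF that(1)]] by simp
    then have "papp d (q - [:cnj c:] + [:cnj c:]) w = papp d [:cnj c:] w"
      by (subst papp_add[OF assms(2)]) simp
    then show ?thesis by (simp add: papp_const[OF assms(2)])
  qed
  note bil = bilinear_cbr[OF assms(1)]
  have lin: "linear (papp d q)" by (rule linear_papp[OF assms(2)])
  have lins: "linear (\<lambda>x. cbr br x y)" "linear (\<lambda>y. cbr br x y)" for x y
    using bil unfolding bilinear_def by blast+
  let ?V = "\<Union>c\<in>S. gen_eigenspace d c N"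
  have base: "papp d q (cbr br x y) = cbr br (papp d q x) y + cbr br x (papp d q y)"
    if xy: "x \<in> ?V" "y \<in> ?V" for x y
  proof -
    obtain a b where ab: "a \<in> S" "b \<in> S" "x \<in> gen_eigenspace d a N" "y \<in> gen_eigenspace d b N"
      using xy by blast
    then have xy': "x \<in> gen_eigenspace d a (N + N)" "y \<in> gen_eigenspace d b (N + N)"
      using gen_eigenspace_mono[OF assms(2)] by (meson le_add1 subsetD)+
    have "cbr br x y \<in> gen_eigenspace d (a + b) (N + N)"
      using cbr_gen_eigenspace[OF assms(1-3)] ab by blast
    moreover have "a + b \<in> R" "a \<in> R" "b \<in> R" using ab by (force simp: R_def)+
    ultimately show ?thesis
      using xy' by (simp add: act cbr_cscale[OF assms(1)] cscale_add_left)
  qed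
  have all: "v \<in> span ?V" for v using S(2) by simp
  have left: "linear (\<lambda>x. papp d q (cbr br x y))"
    "linear (\<lambda>x. cbr br (papp d q x) y + cbr br x (papp d q y))" for y
    using linear_compose[OF lins(1) lin] linear_compose_add[OF linear_compose[OF lin lins(1)] lins(1)]
    unfolding o_def .
  have right: "linear (\<lambda>y. papp d q (cbr br x y))"
    "linear (\<lambda>y. cbr br (papp d q x) y + cbr br x (papp d q y))" for x
    using linear_compose[OF lins(2) lin] linear_compose_add[OF lins(2) linear_compose[OF lin lins(2)]]
    unfolding o_def .
  have ext: "papp d q (cbr br x y) = cbr br (papp d q x) y + cbr br x (papp d q y)"
    if "y \<in> ?V" for x y
    by (rule linear_eq_on_span[OF left base[OF _ that] all])
  have "papp d q (cbr br x y) = cbr br (papp d q x) y + cbr br x (papp d q y)" for x y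
    by (rule linear_eq_on_span[OF right ext all])
  moreover have "poly q c = cnj c" if "c \<in> T" for c
  proof -
    have "[:- c, 1:] dvd q - [:cnj c:]"
      using q[of c] that by (auto simp: R_def intro: dvd_mult_left)
    then show ?thesis by (simp add: poly_eq_0_iff_dvd[symmetric])
  qed
  ultimately show thesis using that by blast
qed

section \<open>The Killing form\<close>

lemma lie_bilinear: "lie_algebra br \<Longrightarrow> bilinear br"
  by (simp add: lie_algebra_def)

lemma linear_ad: "lie_algebra br \<Longrightarrow> linear (br x)"
  by (simp add: lie_algebra_def bilinear_def)

lemma lie_antisym:
  assumes "lie_algebra br"
  shows "br y x = - br x y"
proof -
  have "br (x + y) (x + y) = 0" "br x x = 0" "br y y = 0"
    using assms by (auto simp: lie_algebra_def)
  then have "br x y + br y x = 0"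
    by (simp add: bilinear_ladd[OF lie_bilinear[OF assms]] bilinear_radd[OF lie_bilinear[OF assms]] add.commute)
  then show ?thesis using add_eq_0_iff by blast
qed

lemma ad_derivation:
  assumes "lie_algebra br"
  shows "br x (br y z) = br (br x y) z + br y (br x z)"
proof -
  have "br x (br y z) + br y (br z x) + br z (br x y) = 0"
    using assms by (auto simp: lie_algebra_def)
  moreover have "br y (br z x) = - br y (br x z)"
    unfolding lie_antisym[OF assms, of z x] linear_neg[OF linear_ad[OF assms]] by simp
  moreover have "br z (br x y) = - br (br x y) z"
    by (rule lie_antisym[OF assms])
  ultimately show ?thesis by (simp add: eq_diff_eq diff_eq_eq add.commute)
qed

lemma ad_bracket:
  "lie_algebra br \<Longrightarrow> br (br x y) z = br x (br y z) - br y (br x z)"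
  by (simp add: ad_derivation[of br x y z])

lemma tr_add: "tr (\<lambda>v. f v + g v) = tr f + tr g"
  and tr_diff: "tr (\<lambda>v. f v - g v) = tr f - tr g"
  and tr_scale: "tr (\<lambda>v. c *\<^sub>R f v) = c * tr f"
  by (simp_all add: tr_def inner_add_left inner_diff_left sum.distrib sum_subtractf sum_distrib_left)

lemma tr_compose_commute:
  fixes f g :: "'a::euclidean_space \<Rightarrow> 'a"
  assumes "linear f" "linear g"
  shows "tr (\<lambda>v. f (g v)) = tr (\<lambda>v. g (f v))"
proof -
  have *: "tr (\<lambda>v. f (g v)) = (\<Sum>b\<in>Basis. \<Sum>c\<in>Basis. (g b \<bullet> c) * (f c \<bullet> b))"
    if "linear f" for f g :: "'a \<Rightarrow> 'a"
  proof -
    have "f (g b) = (\<Sum>c\<in>Basis. (g b \<bullet> c) *\<^sub>R f c)" for b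
    proof -
      have "f (g b) = f (\<Sum>c\<in>Basis. (g b \<bullet> c) *\<^sub>R c)" by (simp add: euclidean_representation)
      then show ?thesis using that by (simp add: linear_sum linear_scale)
    qed
    then show ?thesis by (simp add: tr_def inner_sum_left)
  qed
  show ?thesis
    unfolding *[OF assms(1)] *[OF assms(2)] by (subst sum.swap) (simp add: mult.commute)
qed

text \<open>Invariance of the trace form: the two subtracted terms differ by a cyclic rotation. It
  is used for three \<open>ad\<close> maps and also with a derivation as first or last
  factor.\<close>

lemma tr_commutator:
  fixes f g h :: "'a::euclidean_space \<Rightarrow> 'a"
  assumes "linear f" "linear g" "linear h"
  shows "tr (\<lambda>v. f (g (h v)) - g (f (h v))) = tr (\<lambda>v. f (g (h v)) - f (h (g v)))"
  using tr_compose_commute[OF assms(2) linear_compose[OF assms(3,1), unfolded o_def]]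
  by (simp add: tr_diff)

definition killing :: "('a::euclidean_space \<Rightarrow> 'a \<Rightarrow> 'a) \<Rightarrow> 'a \<Rightarrow> 'a \<Rightarrow> real" where
  "killing br x y = tr (\<lambda>v. br x (br y v))"

lemma linear_killing:
  assumes "lie_algebra br"
  shows "linear (killing br x)" "linear (\<lambda>x. killing br x y)"
proof -
  note bil = lie_bilinear[OF assms]
  show "linear (killing br x)"
    by (rule linearI)
      (simp_all add: killing_def bilinear_ladd[OF bil] bilinear_lmul[OF bil] bilinear_radd[OF bil]
        bilinear_rmul[OF bil] tr_add tr_scale)
  then show "linear (\<lambda>x. killing br x y)"
    by (rule_tac linearI)
      (simp_all add: killing_def bilinear_ladd[OF bil] bilinear_lmul[OF bil] tr_add tr_scale)
qed

lemma killing_invariant: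
  assumes "lie_algebra br"
  shows "killing br (br x y) z = killing br x (br y z)"
proof -
  have "killing br (br x y) z = tr (\<lambda>v. br x (br y (br z v)) - br y (br x (br z v)))"
    by (simp add: killing_def ad_bracket[OF assms])
  also have "\<dots> = tr (\<lambda>v. br x (br y (br z v)) - br x (br z (br y v)))"
    by (rule tr_commutator[OF linear_ad linear_ad linear_ad, OF assms assms assms])
  also have "\<dots> = killing br x (br y z)"
    by (simp add: killing_def ad_bracket[OF assms] linear_diff[OF linear_ad[OF assms]])
  finally show ?thesis .
qed

text \<open>The usual induction over subalgebras takes the form of choosing a \<open>good\<close>
  subalgebra of maximal dimension and showing that it is everything.\<close>

lemma engel:
  fixes br :: "'a::euclidean_space \<Rightarrow> 'a \<Rightarrow> 'a"
  assumes lie: "lie_algebra br" and nil: "\<And>x v. \<exists>n. (br x ^^ n) v = 0"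
  obtains w where "w \<noteq> 0" "\<And>x. br x w = 0"
proof -
  define stable where "stable K U \<longleftrightarrow> Real_Vector_Spaces.subspace U \<and> (\<forall>k\<in>K. \<forall>u\<in>U. br k u \<in> U)" for K U
  \<comment> \<open>The second conjunct says, without quotient spaces, that every nonzero quotient
    module W / U has a nonzero vector killed by K. The pair K, \<open>UNIV\<close> will give a
    normalizing element, the pair {0}, \<open>UNIV\<close> the conclusion.\<close>
  define good where "good K \<longleftrightarrow> stable K K \<and>
      (\<forall>U W. stable K U \<longrightarrow> stable K W \<longrightarrow> U \<subset> W \<longrightarrow> (\<exists>w\<in>W - U. \<forall>k\<in>K. br k w \<in> U))" for K
  note bil = lie_bilinear[OF lie]
  have "good {0}"
    by (auto simp: good_def stable_def subspace_0 bilinear_lzero[OF bil])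
  moreover have "\<forall>K. good K \<longrightarrow> dim K < Suc DIM('a)"
    by (simp add: dim_subset_UNIV less_Suc_eq_le)
  ultimately obtain K where K: "good K" and max: "\<And>L. good L \<Longrightarrow> dim L \<le> dim K"
    using ex_has_greatest_nat[of good "{0}" dim "Suc DIM('a)"] by auto
  have step: "\<exists>w. w \<in> W \<and> w \<notin> U \<and> (\<forall>k\<in>K. br k w \<in> U)"
    if "stable K U" "stable K W" "U \<subset> W" for U W
    using K[unfolded good_def, THEN conjunct2, rule_format, OF that] by blast
  have subK: "Real_Vector_Spaces.subspace K" using K by (simp add: good_def stable_def)
  \<comment> \<open>A proper \<open>K\<close> acts on the whole algebra modulo \<open>K\<close>, so some \<open>x \<notin> K\<close> normalizes it, and \<open>K + \<real> x\<close> is still good.\<close>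
  have "K = UNIV"
  proof (rule ccontr)
    assume "K \<noteq> UNIV"
    then have "K \<subset> UNIV" by blast
    moreover have "stable K UNIV" by (simp add: stable_def)
    moreover have "stable K K" using K by (simp add: good_def)
    ultimately obtain x where x: "x \<notin> K" "\<And>k. k \<in> K \<Longrightarrow> br k x \<in> K"
      using step[of K UNIV] by auto
    define L where "L = {k + c *\<^sub>R x | k c. k \<in> K}"
    have "K \<subseteq> L"
    proof
      fix k assume "k \<in> K"
      moreover have "k = k + 0 *\<^sub>R x" by simp
      ultimately show "k \<in> L" unfolding L_def by blast
    qed
    have "x = 0 + 1 *\<^sub>R x" by simp
    then have "x \<in> L"
      unfolding L_def using subspace_0[OF subK] by blast
    have "Real_Vector_Spaces.subspace L"
    proof (rule subspaceI)
      show "0 \<in> L" using \<open>K \<subseteq> L\<close> subspace_0[OF subK] by blast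
    next
      fix a b assume "a \<in> L" "b \<in> L"
      then obtain k c k' c' where "a = k + c *\<^sub>R x" "b = k' + c' *\<^sub>R x" "k \<in> K" "k' \<in> K"
        by (auto simp: L_def)
      then have "a + b = (k + k') + (c + c') *\<^sub>R x" "k + k' \<in> K"
        using subspace_add[OF subK] by (auto simp: algebra_simps)
      then show "a + b \<in> L" unfolding L_def by blast
    next
      fix r a assume "a \<in> L"
      then obtain k c where "a = k + c *\<^sub>R x" "k \<in> K" by (auto simp: L_def)
      then have "r *\<^sub>R a = r *\<^sub>R k + (r * c) *\<^sub>R x" "r *\<^sub>R k \<in> K"
        using subspace_scale[OF subK] by (auto simp: algebra_simps)
      then show "r *\<^sub>R a \<in> L" unfolding L_def by blast
    qed
    have "br a b \<in> K" if ab: "a \<in> L" "b \<in> L" for a b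
    proof -
      obtain k c k' c' where *: "a = k + c *\<^sub>R x" "b = k' + c' *\<^sub>R x" "k \<in> K" "k' \<in> K"
        using ab unfolding L_def by blast
      have "br x x = 0" using lie by (simp add: lie_algebra_def)
      then have "br a b = br k k' + c' *\<^sub>R br k x - c *\<^sub>R br k' x"
        using lie_antisym[OF lie, of x k'] unfolding *(1,2)
        by (simp add: bilinear_ladd[OF bil] bilinear_radd[OF bil] bilinear_lmul[OF bil] bilinear_rmul[OF bil])
      moreover have "br k k' \<in> K" using K * by (simp add: good_def stable_def)
      ultimately show ?thesis
        using x(2) * by (simp add: subspace_add[OF subK] subspace_diff[OF subK] subspace_scale[OF subK])
    qed
    then have "stable L L" using \<open>Real_Vector_Spaces.subspace L\<close> \<open>K \<subseteq> L\<close> by (auto simp: stable_def)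
    moreover have "\<exists>w\<in>W - U. \<forall>l\<in>L. br l w \<in> U" if UW: "stable L U" "stable L W" "U \<subset> W" for U W
    proof -
      have "stable K U" "stable K W" using UW \<open>K \<subseteq> L\<close> by (auto simp: stable_def)
      then obtain w where w: "w \<in> W" "w \<notin> U" "\<And>k. k \<in> K \<Longrightarrow> br k w \<in> U"
        using step[OF _ _ UW(3)] by auto
      have subU: "Real_Vector_Spaces.subspace U" using UW by (simp add: stable_def)
      have xU: "br x u \<in> U" if "u \<in> U" for u
        using UW(1) \<open>x \<in> L\<close> that by (simp add: stable_def)
      \<comment> \<open>Applying x preserves the property that K moves the vector into U: [k,
        [x, v]] = [[k, x], v] + [x, [k, v]], where [k, x] lies in K and U is stable under x.\<close>
      have iter: "(br x ^^ i) w \<in> W \<and> (\<forall>k\<in>K. br k ((br x ^^ i) w) \<in> U)" for i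
      proof (induction i)
        case (Suc i)
        let ?v = "(br x ^^ i) w"
        have "br k (br x ?v) \<in> U" if "k \<in> K" for k
          unfolding ad_derivation[OF lie, of k x]
          using Suc x(2) that by (intro subspace_add[OF subU] xU) auto
        moreover have "br x ?v \<in> W"
          using UW(2) \<open>x \<in> L\<close> Suc by (simp add: stable_def)
        ultimately show ?case by simp
      qed (use w in auto)
      \<comment> \<open>The last iterate outside U is moved into U by x as well, hence by all of
        L.\<close>
      define n where "n = (LEAST n. (br x ^^ n) w \<in> U)"
      have "\<exists>n. (br x ^^ n) w \<in> U"
        using nil[of x w] subspace_0[OF subU] by metis
      then have n: "(br x ^^ n) w \<in> U" unfolding n_def by (rule LeastI_ex)
      with w have "n \<noteq> 0" by (auto intro: ccontr)
      then obtain m where m: "n = Suc m" using not0_implies_Suc by blast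
      have "(br x ^^ m) w \<notin> U"
        using not_less_Least[of m "\<lambda>n. (br x ^^ n) w \<in> U"] m n_def by simp
      moreover have "br l ((br x ^^ m) w) \<in> U" if l: "l \<in> L" for l
      proof -
        obtain k c where "l = k + c *\<^sub>R x" "k \<in> K" using l by (auto simp: L_def)
        moreover have "br x ((br x ^^ m) w) \<in> U" using n m by simp
        ultimately show ?thesis
          using iter[of m]
          by (simp add: bilinear_ladd[OF bil] bilinear_lmul[OF bil] subspace_add[OF subU] subspace_scale[OF subU])
      qed
      ultimately show ?thesis using iter[of m] by blast
    qed
    ultimately have "good L" by (simp add: good_def)
    have "K \<subset> L" using \<open>K \<subseteq> L\<close> \<open>x \<in> L\<close> x(1) by blast
    moreover have "span K = K" "span L = L"
      using subK \<open>Real_Vector_Spaces.subspace L\<close> by (simp_all only: real_vector.span_eq_iff)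
    ultimately have "dim K < dim L"
      by (intro dim_psubset) (simp only:)
    then show False using max[OF \<open>good L\<close>] by simp
  qed
  moreover have "stable UNIV {0}" "stable UNIV UNIV"
    by (auto simp: stable_def bilinear_rzero[OF bil])
  moreover have "{0} \<subset> (UNIV :: 'a set)"
    using nonzero_Basis[OF SOME_Basis] by blast
  ultimately obtain w where "w \<noteq> 0" "\<forall>k. br k w = 0"
    using step[of "{0}" UNIV] by auto
  then show thesis using that by blast
qed

section \<open>Simple algebras: nondegeneracy of the Killing form and its consequences\<close>

lemma simple_lie: "simple_lie_algebra br \<Longrightarrow> lie_algebra br"
  by (simp add: simple_lie_algebra_def)

lemma simple_ideal:
  "simple_lie_algebra br \<Longrightarrow> lie_ideal br I \<Longrightarrow> I = {0} \<or> I = UNIV"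
  by (simp add: simple_lie_algebra_def)

lemma simple_not_abelian: "simple_lie_algebra br \<Longrightarrow> \<exists>x y. br x y \<noteq> 0"
  by (simp add: simple_lie_algebra_def)

lemma simple_perfect:
  assumes "simple_lie_algebra br"
  shows "span {br x y | x y. True} = UNIV"
proof -
  have "lie_ideal br (span {br x y | x y. True})"
    by (auto simp: lie_ideal_def intro: span_base)
  moreover have "span {br x y | x y. True} \<noteq> {0}"
    using simple_not_abelian[OF assms] span_base[of _ "{br x y | x y. True}"] by blast
  ultimately show ?thesis using simple_ideal[OF assms] by blast
qed

lemma simple_center_trivial:
  assumes "simple_lie_algebra br" "\<And>x. br x w = 0"
  shows "w = 0"
proof -
  note bil = lie_bilinear[OF simple_lie[OF assms(1)]]
  have "lie_ideal br {w. \<forall>x. br x w = 0}"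
    by (auto simp: lie_ideal_def real_vector.subspace_def bilinear_radd[OF bil] bilinear_rmul[OF bil] bilinear_rzero[OF bil])
  from simple_ideal[OF assms(1) this] show ?thesis
    using simple_not_abelian[OF assms(1)] assms(2) by blast
qed

text \<open>For x = [y, z], invariance of the trace gives tr (ad y o [ad z, E]), and [ad z, E] = -
  ad (E z), so the trace is a value of the Killing form. Such brackets span.\<close>

lemma tr_ad_derivation_eq_0:
  assumes "simple_lie_algebra br" and kill: "\<And>x y. killing br x y = 0"
    and E: "linear E" "\<And>x y. E (br x y) = br (E x) y + br x (E y)"
  shows "tr (\<lambda>v. br x (E v)) = 0"
proof -
  note lie = simple_lie[OF assms(1)]
  note bil = lie_bilinear[OF lie]
  have "linear (\<lambda>x. tr (\<lambda>v. br x (E v)))"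
    by (rule linearI) (simp_all add: bilinear_ladd[OF bil] bilinear_lmul[OF bil] tr_add tr_scale)
  moreover have "tr (\<lambda>v. br (br y z) (E v)) = 0" for y z
  proof -
    have "tr (\<lambda>v. br (br y z) (E v)) = tr (\<lambda>v. br y (br z (E v)) - br z (br y (E v)))"
      by (simp add: ad_bracket[OF lie])
    also have "\<dots> = tr (\<lambda>v. br y (br z (E v)) - br y (E (br z v)))"
      by (rule tr_commutator[OF linear_ad[OF lie] linear_ad[OF lie] E(1)])
    also have "\<dots> = tr (\<lambda>v. (- 1) *\<^sub>R br y (br (E z) v))"
      by (simp add: E(2) bilinear_radd[OF bil])
    also have "\<dots> = - killing br y (E z)" by (simp only: tr_scale killing_def)
    finally show ?thesis by (simp add: kill)
  qed
  ultimately show ?thesis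
    using linear_eq_0_on_span[of "\<lambda>x. tr (\<lambda>v. br x (E v))" "{br x y | x y. True}" x]
      simple_perfect[OF assms(1)] by blast
qed

text \<open>The exponent \<open>Suc k\<close> accounts for the extra factor d in the trace of d o
  q(d).\<close>

lemma sum_coeff_power_sums:
  fixes q :: "complex poly"
  shows "(\<Sum>k\<le>degree q. coeff q k * (\<Sum>e\<leftarrow>es. e ^ Suc k)) = (\<Sum>e\<leftarrow>es. e * poly q e)"
  by (induction es) (simp_all add: algebra_simps sum.distrib poly_altdef sum_distrib_left)

lemma ad_nilpotent_of_killing_0:
  fixes br :: "'a::euclidean_space \<Rightarrow> 'a \<Rightarrow> 'a"
  assumes "simple_lie_algebra br" and kill: "\<And>x y. killing br x y = 0"
  shows "br x ^^ DIM('a) = (\<lambda>_. 0)"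
proof -
  note lie = simple_lie[OF assms(1)]
  define d where "d = br x"
  have d: "linear d" "\<And>u v. d (br u v) = br (d u) v + br u (d v)"
    unfolding d_def by (rule linear_ad[OF lie], rule ad_derivation[OF lie])
  obtain es where es: "\<And>k. complex_of_real (tr (d ^^ k)) = (\<Sum>e\<leftarrow>es. e ^ k)"
    and nil: "\<forall>e\<in>set es. e = 0 \<Longrightarrow> d ^^ DIM('a) = (\<lambda>_. 0)"
    using trace_powers_eq_power_sums[OF d(1)] by metis
  obtain q where q: "\<And>c. c \<in> set es \<Longrightarrow> poly q c = cnj c"
    and der: "\<And>u v. papp d q (cbr br u v) = cbr br (papp d q u) v + cbr br u (papp d q v)"
    using derivation_interpolating_cnj[OF lie_bilinear[OF lie] d, of "set es"] by auto
  \<comment> \<open>For real arguments (u, 0) and (v, 0) the first component of the complex Leibniz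
    rule involves only first components, so the real part of q(d) is a real derivation.\<close>
  define E where "E u = fst (papp d q (u, 0))" for u
  have E: "E u = (\<Sum>k\<le>degree q. Re (coeff q k) *\<^sub>R (d ^^ k) u)" for u
    by (simp add: E_def papp_def fst_sum cscale_def linear_0[OF linear_funpow[OF d(1)]])
  have "linear (\<lambda>u. \<Sum>k\<le>degree q. Re (coeff q k) *\<^sub>R (d ^^ k) u)"
    by (intro linear_compose_sum ballI linear_compose_scale_right linear_funpow d(1))
  then have "linear E" unfolding E[abs_def] .
  moreover have "E (br u v) = br (E u) v + br u (E v)" for u v
    using arg_cong[OF der[of "(u, 0)" "(v, 0)"], of fst]
    by (simp add: E_def cbr_def bilinear_lzero[OF lie_bilinear[OF lie]] bilinear_rzero[OF lie_bilinear[OF lie]])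
  ultimately have "tr (\<lambda>v. d (E v)) = 0"
    unfolding d_def by (rule tr_ad_derivation_eq_0[OF assms])
  \<comment> \<open>\<open>E\<close> is the polynomial in d whose coefficients are the real parts of
    those of q. Traces of powers of d are real, so \<open>Re\<close> can be taken outside the
    sum.\<close>
  moreover have "tr (\<lambda>v. d (E v)) = (\<Sum>k\<le>degree q. Re (coeff q k) * tr (d ^^ Suc k))"
    by (simp add: tr_def E linear_sum[OF d(1)] linear_scale[OF d(1)] inner_sum_left sum_distrib_left)
      (rule sum.swap)
  moreover have "\<dots> = Re (\<Sum>k\<le>degree q. coeff q k * complex_of_real (tr (d ^^ Suc k)))"
    by (simp del: funpow.simps)
  moreover have "\<dots> = Re (\<Sum>e\<leftarrow>es. e * poly q e)"
    unfolding es sum_coeff_power_sums ..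
  moreover have "(\<Sum>e\<leftarrow>es. e * poly q e) = (\<Sum>e\<leftarrow>es. complex_of_real ((cmod e)\<^sup>2))"
    by (intro arg_cong[of _ _ sum_list] map_cong refl) (simp only: q complex_norm_square)
  moreover have "Re (\<Sum>e\<leftarrow>es. complex_of_real ((cmod e)\<^sup>2)) = (\<Sum>e\<leftarrow>es. (cmod e)\<^sup>2)"
    by (induction es) auto
  ultimately have "(\<Sum>e\<leftarrow>es. (cmod e)\<^sup>2) = 0" by simp
  then have "\<forall>e\<in>set es. e = 0"
    by (subst (asm) sum_list_nonneg_eq_0_iff) auto
  from nil[OF this] show ?thesis by (simp add: d_def)
qed

text \<open>By invariance the radical is an ideal, so it is {0} or everything; only the totally
  degenerate case needs the nilpotency argument.\<close>

theorem killing_nondegenerate: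
  fixes br :: "'a::euclidean_space \<Rightarrow> 'a \<Rightarrow> 'a"
  assumes "simple_lie_algebra br" "\<And>y. killing br x y = 0"
  shows "x = 0"
proof -
  note lie = simple_lie[OF assms(1)]
  note lin = linear_killing(2)[OF lie]
  let ?R = "{x. \<forall>y. killing br x y = 0}"
  have "lie_ideal br ?R"
    unfolding lie_ideal_def
  proof (intro conjI allI impI)
    show "Real_Vector_Spaces.subspace ?R"
      by (auto intro!: subspaceI simp: linear_0[OF lin] linear_add[OF lin] linear_scale[OF lin])
    fix x y assume "y \<in> ?R"
    then show "br x y \<in> ?R"
      unfolding lie_antisym[OF lie, of x y] by (simp add: linear_neg[OF lin] killing_invariant[OF lie])
  qed
  moreover have "?R \<noteq> UNIV"
  proof
    assume "?R = UNIV"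
    then have "br x ^^ DIM('a) = (\<lambda>_. 0)" for x
      by (intro ad_nilpotent_of_killing_0[OF assms(1)]) auto
    then have "\<exists>n. (br x ^^ n) v = 0" for x v by metis
    from engel[OF lie this] obtain w where "w \<noteq> 0" "\<And>x. br x w = 0" by blast
    then show False using simple_center_trivial[OF assms(1)] by blast
  qed
  ultimately show ?thesis using simple_ideal[OF assms(1)] assms(2) by blast
qed

lemma killing_represents:
  fixes br :: "'a::euclidean_space \<Rightarrow> 'a \<Rightarrow> 'a" and \<phi> :: "'a \<Rightarrow> real"
  assumes "simple_lie_algebra br" "linear \<phi>"
  obtains c where "\<phi> = killing br c"
proof -
  note lie = simple_lie[OF assms(1)]
  note lin = linear_killing[OF lie]
  \<comment> \<open>Recording a functional by its values on \<open>Basis\<close> turns c ->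
    \<open>killing br c\<close> into an endomorphism of the algebra, for which injective implies
    surjective.\<close>
  define F where "F c = (\<Sum>b\<in>Basis. killing br c b *\<^sub>R b)" for c
  have F_inner: "F c \<bullet> b = killing br c b" if "b \<in> Basis" for b c
    using that by (simp add: F_def)
  have "linear F"
    unfolding F_def
    by (rule linearI) (simp_all add: linear_add[OF lin(2)] linear_scale[OF lin(2)] algebra_simps sum.distrib scaleR_sum_right)
  moreover have "c = 0" if "F c = 0" for c
  proof -
    have "killing br c = (\<lambda>_. 0)"
      using F_inner[of _ c] that by (intro linear_eq_stdbasis lin linear_zero) simp
    then show ?thesis using killing_nondegenerate[OF assms(1), of c] by metis
  qed
  ultimately have "surj F"
    by (intro linear_injective_imp_surjective) (auto simp: linear_injective_0)
  then obtain c where c: "(\<Sum>b\<in>Basis. \<phi> b *\<^sub>R b) = F c" by (metis surjD)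
  have "\<phi> b = killing br c b" if "b \<in> Basis" for b
    using arg_cong[OF c, of "\<lambda>v. v \<bullet> b"] F_inner[OF that] that by simp
  then have "\<phi> = killing br c"
    by (intro linear_eq_stdbasis assms(2) lin) auto
  then show thesis by (rule that)
qed

text \<open>Pick a so that F = E - ad a is trace-orthogonal to all ad y. Since ad (F u) = [F, ad u],
  the Killing product of F u and v is tr (F o ad [u, v]) = 0, and nondegeneracy gives F = 0.\<close>

lemma simple_derivation_inner:
  fixes br :: "'a::euclidean_space \<Rightarrow> 'a \<Rightarrow> 'a"
  assumes "simple_lie_algebra br" and E: "linear E" "\<And>x y. E (br x y) = br (E x) y + br x (E y)"
  obtains a where "E = br a"
proof -
  note lie = simple_lie[OF assms(1)]
  note bil = lie_bilinear[OF lie]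
  have "linear (\<lambda>y. tr (\<lambda>v. E (br y v)))"
    by (rule linearI)
      (simp_all add: bilinear_ladd[OF bil] bilinear_lmul[OF bil] linear_add[OF E(1)] linear_scale[OF E(1)] tr_add tr_scale)
  from killing_represents[OF assms(1) this]
  obtain a where a: "(\<lambda>y. tr (\<lambda>v. E (br y v))) = killing br a" .
  define F where "F v = E v - br a v" for v
  have F: "linear F" "F (br u v) = br (F u) v + br u (F v)" for u v
    unfolding F_def
    by (intro linear_compose_sub E linear_ad[OF lie])
      (simp add: E(2) ad_derivation[OF lie, of a] bilinear_lsub[OF bil] bilinear_rsub[OF bil])
  have trF: "tr (\<lambda>v. F (br y v)) = 0" for y
    using fun_cong[OF a, of y] by (simp add: F_def tr_diff killing_def)
  have "F u = 0" for u
  proof (rule killing_nondegenerate[OF assms(1)])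
    fix v
    have "killing br (F u) v = tr (\<lambda>w. F (br u (br v w)) - br u (F (br v w)))"
      by (simp add: killing_def F(2))
    also have "\<dots> = tr (\<lambda>w. F (br u (br v w)) - F (br v (br u w)))"
      by (rule tr_commutator[OF F(1) linear_ad[OF lie] linear_ad[OF lie]])
    also have "\<dots> = tr (\<lambda>w. F (br (br u v) w))"
      by (simp add: ad_bracket[OF lie] linear_diff[OF F(1)])
    finally show "killing br (F u) v = 0" by (simp add: trF)
  qed
  then have "E = br a" by (auto simp: F_def)
  then show thesis by (rule that)
qed

section \<open>The cotangent extension\<close>

lemma tstar_carrier_iff: "x \<in> tstar_carrier \<longleftrightarrow> linear (snd x)"
  by (cases x) (simp add: tstar_carrier_def)

lemma tbr_closed:
  assumes "lie_algebra br" "x \<in> tstar_carrier" "y \<in> tstar_carrier"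
  shows "tbr br x y \<in> tstar_carrier"
proof -
  have "linear (\<lambda>w. - snd y (br (fst x) w))" "linear (\<lambda>w. snd x (br (fst y) w))"
    using assms(2,3) linear_compose[OF linear_ad[OF assms(1)], unfolded o_def]
    by (auto simp: tstar_carrier_iff intro!: linear_compose_neg)
  then show ?thesis
    unfolding tstar_carrier_iff tbr_def snd_conv by (rule linear_compose_add)
qed

lemma tform_sym: "tform x y = tform y x"
  by (simp add: tform_def)

lemma tform_invariant:
  assumes "lie_algebra br" "x \<in> tstar_carrier" "y \<in> tstar_carrier" "z \<in> tstar_carrier"
  shows "tform (tbr br x y) z = tform x (tbr br y z)"
  using assms lie_antisym[OF assms(1), of "fst z" "fst x"] lie_antisym[OF assms(1), of "fst y" "fst x"]
  by (simp add: tform_def tbr_def tstar_carrier_iff linear_neg)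

lemma tbr_antisym:
  assumes "lie_algebra br" "x \<in> tstar_carrier" "y \<in> tstar_carrier"
  shows "tbr br y x = tscale (- 1) (tbr br x y)"
  using lie_antisym[OF assms(1), of "fst y" "fst x"] by (simp add: tbr_def tscale_def)

lemma tadd_in_carrier: "x \<in> tstar_carrier \<Longrightarrow> y \<in> tstar_carrier \<Longrightarrow> tadd x y \<in> tstar_carrier"
  by (simp add: tstar_carrier_iff tadd_def linear_compose_add)

lemma tlinear_tform_left: "tlinear (\<lambda>x. tform x y)" if "y \<in> tstar_carrier"
  using that
  by (simp add: tlinear_def tform_def tadd_def tscale_def tstar_carrier_iff linear_add linear_scale algebra_simps)

lemma tlinear_tform_right: "tlinear (tform y)" if "y \<in> tstar_carrier"
proof -
  have "tform y = (\<lambda>x. tform x y)" by (rule ext) (rule tform_sym)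
  then show ?thesis using tlinear_tform_left[OF that] by simp
qed

section \<open>Duality for the canonical form, and skew derivations\<close>

lemma tform_nondegenerate:
  fixes x y :: "'a::euclidean_space tstar"
  assumes "\<And>z. z \<in> tstar_carrier \<Longrightarrow> tform x z = tform y z"
  shows "x = y"
proof (rule prod_eqI)
  \<comment> \<open>Since x and y are not assumed to lie in the carrier, \<open>snd x 0\<close> may
    be nonzero; the zero test vector cancels it.\<close>
  have "fst x \<bullet> w = fst y \<bullet> w" for w
    using assms[of "(0, \<lambda>v. v \<bullet> w)"] assms[of "(0, \<lambda>_. 0)"]
    by (simp add: tform_def tstar_carrier_iff linear_zero bounded_linear.linear[OF bounded_linear_inner_left])
  then show "fst x = fst y" by (metis vector_eq_rdot)
  then show "snd x = snd y"
    using assms[of "(w, \<lambda>_. 0)" for w] by (auto simp: tform_def tstar_carrier_iff linear_zero)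
qed

lemma tlinear_represents:
  fixes \<phi> :: "'a::euclidean_space tstar \<Rightarrow> real"
  assumes "tlinear \<phi>"
  shows "\<exists>x\<in>tstar_carrier. \<forall>y\<in>tstar_carrier. \<phi> y = tform x y"
proof -
  have add: "\<phi> (tadd x y) = \<phi> x + \<phi> y" if "x \<in> tstar_carrier" "y \<in> tstar_carrier" for x y
    using assms that by (simp add: tlinear_def)
  have scale: "\<phi> (tscale c x) = c * \<phi> x" if "x \<in> tstar_carrier" for c x
    using assms that by (simp add: tlinear_def)
  have dual: "(0, \<lambda>v. v \<bullet> b) \<in> tstar_carrier" for b :: 'a
    by (simp add: tstar_carrier_iff bounded_linear.linear[OF bounded_linear_inner_left])
  have vec: "(v, \<lambda>_. 0) \<in> tstar_carrier" for v :: 'a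
    by (simp add: tstar_carrier_iff linear_zero)
  \<comment> \<open>The pairing exchanges the summands: the vector part is read off on coordinate
    functionals, the functional part on vectors.\<close>
  define x where "x = (\<Sum>b\<in>Basis. \<phi> (0, \<lambda>v. v \<bullet> b) *\<^sub>R b, \<lambda>v. \<phi> (v, \<lambda>_. 0))"
  have "x \<in> tstar_carrier"
    unfolding tstar_carrier_iff x_def snd_conv
  proof (rule linearI)
    show "\<phi> (u + v, \<lambda>_. 0) = \<phi> (u, \<lambda>_. 0) + \<phi> (v, \<lambda>_. 0)" for u v
      using add[OF vec[of u] vec[of v]] by (simp add: tadd_def)
    show "\<phi> (c *\<^sub>R u, \<lambda>_. 0) = c *\<^sub>R \<phi> (u, \<lambda>_. 0)" for c u
      using scale[OF vec[of u], of c] by (simp add: tscale_def)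
  qed
  moreover have "\<phi> y = tform x y" if y: "y \<in> tstar_carrier" for y
  proof -
    define \<beta> where "\<beta> = snd y"
    have "linear \<beta>" using y by (simp add: tstar_carrier_iff \<beta>_def)
    have zero: "\<phi> (0, \<lambda>_. 0) = 0"
      using scale[OF vec[of 0], of 0] by (simp add: tscale_def)
    \<comment> \<open>Additivity of \<phi> is available only for pairs in the carrier, so linearity
      of the partial sums is carried through the induction.\<close>
    have sum: "linear (\<lambda>v. \<Sum>b\<in>A. \<beta> b * (v \<bullet> b)) \<and>
        \<phi> (0, \<lambda>v. \<Sum>b\<in>A. \<beta> b * (v \<bullet> b)) = (\<Sum>b\<in>A. \<beta> b * \<phi> (0, \<lambda>v. v \<bullet> b))"
      if "finite A" for A
      using that
    proof (induction A)
      case empty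
      then show ?case by (simp add: zero linear_zero)
    next
      case (insert a A)
      have 1: "linear (\<lambda>v. \<beta> a * (v \<bullet> a))"
        by (rule linearI) (simp_all add: inner_add_left algebra_simps)
      have "\<phi> (0, \<lambda>v. \<Sum>b\<in>insert a A. \<beta> b * (v \<bullet> b)) =
          \<phi> (tadd (tscale (\<beta> a) (0, \<lambda>v. v \<bullet> a)) (0, \<lambda>v. \<Sum>b\<in>A. \<beta> b * (v \<bullet> b)))"
        using insert by (simp add: tadd_def tscale_def)
      also have "\<dots> = \<beta> a * \<phi> (0, \<lambda>v. v \<bullet> a) + \<phi> (0, \<lambda>v. \<Sum>b\<in>A. \<beta> b * (v \<bullet> b))"
        using insert 1 scale[OF dual] by (subst add) (auto simp: tstar_carrier_iff tscale_def)
      finally show ?case using insert linear_compose_add[OF 1] by simp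
    qed
    have "\<beta> v = (\<Sum>b\<in>Basis. \<beta> b * (v \<bullet> b))" for v
    proof -
      have "\<beta> v = \<beta> (\<Sum>b\<in>Basis. (v \<bullet> b) *\<^sub>R b)" by (simp add: euclidean_representation)
      then show ?thesis
        using \<open>linear \<beta>\<close> by (simp add: linear_sum linear_scale mult.commute)
    qed
    then have "\<phi> (0, \<beta>) = (\<Sum>b\<in>Basis. \<beta> b * \<phi> (0, \<lambda>v. v \<bullet> b))"
      using sum[OF finite_Basis] by (metis (no_types, lifting) ext)
    moreover have "\<beta> (fst x) = (\<Sum>b\<in>Basis. \<beta> b * \<phi> (0, \<lambda>v. v \<bullet> b))"
      using \<open>linear \<beta>\<close> by (simp add: x_def linear_sum linear_scale mult.commute)
    moreover have "y = tadd (fst y, \<lambda>_. 0) (0, \<beta>)"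
      by (simp add: tadd_def \<beta>_def)
    then have "\<phi> y = \<phi> (fst y, \<lambda>_. 0) + \<phi> (0, \<beta>)"
      using add[OF vec, of "(0, \<beta>)" "fst y"] \<open>linear \<beta>\<close> by (simp add: tstar_carrier_iff)
    ultimately show ?thesis by (simp add: tform_def x_def \<beta>_def)
  qed
  ultimately show ?thesis by blast
qed

lemma skew_derivation_inner:
  fixes br :: "'a::euclidean_space \<Rightarrow> 'a \<Rightarrow> 'a"
  assumes simple: "simple_lie_algebra br" and der: "tstar_derivation br D" and skew: "tstar_skew D"
  shows "tstar_inner br D"
proof -
  note lie = simple_lie[OF simple]
  note bil = lie_bilinear[OF lie]
  have closed: "linear (snd (D x))" if "linear (snd x)" for x
    using der that by (simp add: tstar_derivation_def tstar_carrier_iff)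
  have add: "D (tadd x y) = tadd (D x) (D y)" if "linear (snd x)" "linear (snd y)" for x y
    using der that by (simp add: tstar_derivation_def tstar_carrier_iff)
  have scale: "D (tscale c x) = tscale c (D x)" if "linear (snd x)" for c x
    using der that by (simp add: tstar_derivation_def tstar_carrier_iff)
  have leib: "D (tbr br x y) = tadd (tbr br (D x) y) (tbr br x (D y))"
    if "linear (snd x)" "linear (snd y)" for x y
    using der that by (simp add: tstar_derivation_def tstar_carrier_iff)
  have skew': "tform (D x) y + tform x (D y) = 0" if "linear (snd x)" "linear (snd y)" for x y
    using skew that by (simp add: tstar_skew_def tstar_carrier_iff)
  \<comment> \<open>The four blocks of \<open>D\<close> for the splitting g + g*. The Leibniz rule
    on g makes \<open>A\<close> a derivation and \<open>B\<close> a 1-cocycle with values in the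
    coadjoint module.\<close>
  define A B where "A u = fst (D (u, \<lambda>_. 0))" and "B u = snd (D (u, \<lambda>_. 0))" for u
  define P Q where "P \<alpha> = fst (D (0, \<alpha>))" and "Q \<alpha> = snd (D (0, \<alpha>))" for \<alpha>
  have D_vec: "D (u, \<lambda>_. 0) = (A u, B u)" for u by (simp add: A_def B_def)
  have D_dual: "D (0, \<alpha>) = (P \<alpha>, Q \<alpha>)" for \<alpha> by (simp add: P_def Q_def)
  have linB: "linear (B u)" and B0: "B u 0 = 0" for u
    using closed[of "(u, \<lambda>_. 0)"] by (auto simp: linear_zero B_def linear_0)
  have linQ: "linear (Q \<alpha>)" if "linear \<alpha>" for \<alpha>
    using closed[of "(0, \<alpha>)"] that by (simp add: Q_def)
  have "tadd (u, \<lambda>_. 0) (v, \<lambda>_. 0) = (u + v, \<lambda>_. 0)" "tscale c (u, \<lambda>_. 0) = (c *\<^sub>R u, \<lambda>_. 0)" for u v :: 'a and c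
    by (simp_all add: tadd_def tscale_def)
  then have D_vec_add: "D (u + v, \<lambda>_. 0) = tadd (D (u, \<lambda>_. 0)) (D (v, \<lambda>_. 0))"
    and D_vec_scale: "D (c *\<^sub>R u, \<lambda>_. 0) = tscale c (D (u, \<lambda>_. 0))" for u v c
    using add[of "(u, \<lambda>_. 0)" "(v, \<lambda>_. 0)"] scale[of "(u, \<lambda>_. 0)" c] by (auto simp: linear_zero)
  have linA: "linear A"
    by (rule linearI) (simp_all add: A_def D_vec_add D_vec_scale, simp_all add: tadd_def tscale_def)
  have B_lin: "B (u + v) w = B u w + B v w" "B (c *\<^sub>R u) w = c * B u w" for u v w c
    by (simp_all add: B_def D_vec_add D_vec_scale, simp_all add: tadd_def tscale_def)
  have "D (br u v, \<lambda>_. 0) = tadd (tbr br (D (u, \<lambda>_. 0)) (v, \<lambda>_. 0)) (tbr br (u, \<lambda>_. 0) (D (v, \<lambda>_. 0)))" for u v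
    using leib[of "(u, \<lambda>_. 0)" "(v, \<lambda>_. 0)"] by (simp add: linear_zero tbr_def)
  then have A_der: "A (br u v) = br (A u) v + br u (A v)"
    and B_der: "B (br u v) w = B u (br v w) - B v (br u w)" for u v w
    by (simp_all add: D_vec tbr_def tadd_def)

  \<comment> \<open>The component of \<open>D\<close> from the dual to the algebra vanishes: its image is an abelian ideal.\<close>
  have P_equiv: "P (\<lambda>w. - \<alpha> (br u w)) = br u (P \<alpha>)" if "linear \<alpha>" for u \<alpha>
  proof -
    have "tbr br (u, \<lambda>_. 0) (0, \<alpha>) = (0, \<lambda>w. - \<alpha> (br u w))"
      using that by (simp add: tbr_def bilinear_rzero[OF bil])
    then show ?thesis
      using leib[of "(u, \<lambda>_. 0)" "(0, \<alpha>)"] that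
      by (simp add: linear_zero D_vec D_dual tbr_def tadd_def bilinear_rzero[OF bil])
  qed
  have P_add: "P (\<lambda>w. \<alpha> w + \<beta> w) = P \<alpha> + P \<beta>" if "linear \<alpha>" "linear \<beta>" for \<alpha> \<beta>
    using add[of "(0, \<alpha>)" "(0, \<beta>)"] that by (simp add: D_dual tadd_def)
  have P_scale: "P (\<lambda>w. c * \<alpha> w) = c *\<^sub>R P \<alpha>" if "linear \<alpha>" for \<alpha> c
    using scale[of "(0, \<alpha>)" c] that by (simp add: D_dual tscale_def)
  \<comment> \<open>The Leibniz rule applied to [\<alpha>, \<beta>] = 0 for two functionals.\<close>
  have P_swap: "\<alpha> (br (P \<beta>) w) = \<beta> (br (P \<alpha>) w)" if "linear \<alpha>" "linear \<beta>" for \<alpha> \<beta> w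
  proof -
    have "tbr br (0, \<alpha>) (0, \<beta>) = (0, \<lambda>_. 0)"
      using that by (simp add: tbr_def bilinear_lzero[OF bil] linear_0)
    moreover have "D (0, \<lambda>_. 0) = (0, \<lambda>_. 0)"
      using D_vec_scale[of 0 0] by (simp add: tscale_def)
    ultimately have "tadd (tbr br (P \<alpha>, Q \<alpha>) (0, \<beta>)) (tbr br (0, \<alpha>) (P \<beta>, Q \<beta>)) = (0, \<lambda>_. 0)"
      using leib[of "(0, \<alpha>)" "(0, \<beta>)"] that by (simp add: D_dual)
    then have "(\<lambda>w. - \<beta> (br (P \<alpha>) w) + \<alpha> (br (P \<beta>) w)) = (\<lambda>_. 0)"
      using that linQ by (simp add: tadd_def tbr_def bilinear_lzero[OF bil] linear_0)
    from fun_cong[OF this, of w] show ?thesis by simp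
  qed
  have P_comm: "br (P \<alpha>) (P \<beta>) = 0" if "linear \<alpha>" "linear \<beta>" for \<alpha> \<beta>
  proof -
    \<comment> \<open>By equivariance the two brackets are the images under \<open>P\<close> of the
      coadjoint actions of P \<beta> on \<alpha> and of P \<alpha> on \<beta>, which
      \<open>P_swap\<close> identifies. The bracket is thus symmetric as well as
      antisymmetric.\<close>
    have "br (P \<beta>) (P \<alpha>) = br (P \<alpha>) (P \<beta>)"
      using P_equiv[of \<alpha> "P \<beta>"] P_equiv[of \<beta> "P \<alpha>"] that P_swap[OF that] by simp
    then have "2 *\<^sub>R br (P \<alpha>) (P \<beta>) = br (P \<beta>) (P \<alpha>) + br (P \<alpha>) (P \<beta>)"
      by (simp add: scaleR_2)
    also have "\<dots> = 0" by (simp add: lie_antisym[OF lie, of "P \<beta>" "P \<alpha>"])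
    finally show ?thesis by simp
  qed
  have "lie_ideal br (P ` {\<alpha>. linear \<alpha>})"
    unfolding lie_ideal_def
  proof (intro conjI allI impI)
    show "Real_Vector_Spaces.subspace (P ` {\<alpha>. linear \<alpha>})"
    proof (rule real_vector.subspaceI)
      have "P (\<lambda>_. 0) = 0" using P_scale[of "\<lambda>_. 0" 0] by (simp add: linear_zero)
      then show "0 \<in> P ` {\<alpha>. linear \<alpha>}"
        by (intro image_eqI[of _ _ "\<lambda>_. 0"]) (auto simp: linear_zero)
    next
      fix x y assume "x \<in> P ` {\<alpha>. linear \<alpha>}" "y \<in> P ` {\<alpha>. linear \<alpha>}"
      then obtain \<alpha> \<beta> where "linear \<alpha>" "linear \<beta>" "x = P \<alpha>" "y = P \<beta>" by blast
      then show "x + y \<in> P ` {\<alpha>. linear \<alpha>}"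
        by (intro image_eqI[of _ _ "\<lambda>w. \<alpha> w + \<beta> w"]) (auto simp: P_add linear_compose_add)
    next
      fix c x assume "x \<in> P ` {\<alpha>. linear \<alpha>}"
      then obtain \<alpha> where "linear \<alpha>" "x = P \<alpha>" by blast
      moreover from this have "linear (\<lambda>w. c * \<alpha> w)"
        using linear_compose_scale_right[of \<alpha> c] by simp
      ultimately show "c *\<^sub>R x \<in> P ` {\<alpha>. linear \<alpha>}"
        by (intro image_eqI[of _ _ "\<lambda>w. c * \<alpha> w"]) (auto simp: P_scale)
    qed
  next
    fix u x assume "x \<in> P ` {\<alpha>. linear \<alpha>}"
    then obtain \<alpha> where \<alpha>: "linear \<alpha>" "x = P \<alpha>" by blast
    moreover have "linear (\<lambda>w. - \<alpha> (br u w))"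
      using linear_compose[OF linear_ad[OF lie] \<alpha>(1)] by (intro linear_compose_neg) (simp add: o_def)
    ultimately show "br u x \<in> P ` {\<alpha>. linear \<alpha>}"
      by (intro image_eqI[of _ _ "\<lambda>w. - \<alpha> (br u w)"]) (auto simp: P_equiv)
  qed
  moreover have "P ` {\<alpha>. linear \<alpha>} \<noteq> UNIV"
  proof
    assume *: "P ` {\<alpha>. linear \<alpha>} = UNIV"
    have "br x y = 0" for x y
    proof -
      have "x \<in> P ` {\<alpha>. linear \<alpha>}" "y \<in> P ` {\<alpha>. linear \<alpha>}" using * by auto
      then show ?thesis using P_comm by auto
    qed
    then show False using simple_not_abelian[OF simple] by blast
  qed
  ultimately have "P ` {\<alpha>. linear \<alpha>} = {0}" using simple_ideal[OF simple] by blast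
  then have P0: "P \<alpha> = 0" if "linear \<alpha>" for \<alpha> using that by blast

  obtain a where a: "A = br a"
    using simple_derivation_inner[OF simple linA A_der] by blast
  \<comment> \<open>Skewness is essential here: (u, \<alpha>) -> (0, \<alpha>) is a derivation that
    is not inner.\<close>
  have Q: "Q \<alpha> u = - \<alpha> (br a u)" if "linear \<alpha>" for \<alpha> u
    using skew'[of "(u, \<lambda>_. 0)" "(0, \<alpha>)"] that B0
    by (simp add: D_vec D_dual tform_def linear_zero a)

  \<comment> \<open>The Killing form identifies g* with g as modules, so the cocycle
    \<open>B\<close> becomes a derivation \<Delta> of g, which is inner.\<close>
  have "\<exists>c. B u = killing br c" for u
    using killing_represents[OF simple linB] by metis
  then obtain \<Delta> where \<Delta>: "\<And>u. B u = killing br (\<Delta> u)" by metis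
  note klin = linear_killing(2)[OF lie]
  have kill_eq: "x = y" if "\<And>w. killing br x w = killing br y w" for x y
    using killing_nondegenerate[OF simple, of "x - y"] that by (simp add: linear_diff[OF klin])
  have lin\<Delta>: "linear \<Delta>"
    by (rule linearI; rule kill_eq)
      (simp_all add: linear_add[OF klin] linear_scale[OF klin] B_lin flip: \<Delta>)
  have "\<Delta> (br u v) = br (\<Delta> u) v + br u (\<Delta> v)" for u v
  proof (rule kill_eq)
    fix w
    have "killing br (br u (\<Delta> v)) w = - killing br (\<Delta> v) (br u w)"
      using lie_antisym[OF lie, of u "\<Delta> v"] by (simp add: linear_neg[OF klin] killing_invariant[OF lie])
    then show "killing br (\<Delta> (br u v)) w = killing br (br (\<Delta> u) v + br u (\<Delta> v)) w"
      using B_der[of u v w] by (simp add: \<Delta> linear_add[OF klin] killing_invariant[OF lie])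
  qed
  then obtain c where c: "\<Delta> = br c"
    using simple_derivation_inner[OF simple lin\<Delta>] by blast

  \<comment> \<open>By invariance \<open>B u\<close>, which is \<open>killing br (br c u)\<close>,
    sends w to \<open>killing br c (br u w)\<close>: precisely the term that the functional
    \<open>killing br c\<close> contributes to \<open>tbr\<close>.\<close>
  have "D x = tbr br (a, killing br c) x" if carrier: "x \<in> tstar_carrier" for x
  proof -
    obtain u \<alpha> where x: "x = (u, \<alpha>)" and \<alpha>: "linear \<alpha>"
      using carrier by (cases x) (auto simp: tstar_carrier_iff)
    have "x = tadd (u, \<lambda>_. 0) (0, \<alpha>)" by (simp add: x tadd_def)
    then have "D x = tadd (A u, B u) (P \<alpha>, Q \<alpha>)"
      using add[of "(u, \<lambda>_. 0)" "(0, \<alpha>)"] \<alpha> by (simp add: linear_zero D_vec D_dual)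
    also have "\<dots> = (br a u, \<lambda>w. B u w + Q \<alpha> w)"
      by (simp add: tadd_def P0[OF \<alpha>] a)
    also have "\<dots> = tbr br (a, killing br c) x"
      by (auto simp: tbr_def x Q[OF \<alpha>] \<Delta> c killing_invariant[OF lie])
    finally show ?thesis .
  qed
  moreover have "(a, killing br c) \<in> tstar_carrier"
    by (simp add: tstar_carrier_iff linear_killing[OF lie])
  ultimately show ?thesis unfolding tstar_inner_def by blast
qed

text \<open>Nondegeneracy yields \<open>D\<close> and its linearity. Antisymmetry of \<omega>
  becomes skewness, and the cocycle identity, once invariance has moved the brackets, is the Leibniz
  rule tested against every z.\<close>

lemma cocycle_skew_derivation:
  fixes br :: "'a::euclidean_space \<Rightarrow> 'a \<Rightarrow> 'a"
  assumes lie: "lie_algebra br" and coc: "tstar_2cocycle br \<omega>"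
  obtains D where "tstar_derivation br D" "tstar_skew D"
    and "\<And>x y. x \<in> tstar_carrier \<Longrightarrow> y \<in> tstar_carrier \<Longrightarrow> \<omega> x y = tform (D x) y"
proof -
  have lin: "tlinear (\<omega> x)" "tlinear (\<lambda>y. \<omega> y x)" and self: "\<omega> x x = 0"
    if "x \<in> tstar_carrier" for x
    using coc that by (auto simp: tstar_2cocycle_def)
  have add: "\<omega> (tadd x y) z = \<omega> x z + \<omega> y z" "\<omega> z (tadd x y) = \<omega> z x + \<omega> z y"
    and scale: "\<omega> (tscale c x) z = c * \<omega> x z" "\<omega> z (tscale c x) = c * \<omega> z x"
    if "x \<in> tstar_carrier" "y \<in> tstar_carrier" "z \<in> tstar_carrier" for x y z c
    using lin[OF that(3)] that by (auto simp: tlinear_def)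
  have alt: "\<omega> y x = - \<omega> x y" if "x \<in> tstar_carrier" "y \<in> tstar_carrier" for x y
    using self[OF tadd_in_carrier[OF that]] self[OF that(1)] self[OF that(2)] that
    by (simp add: add tadd_in_carrier)
  obtain D where D: "\<And>x. x \<in> tstar_carrier \<Longrightarrow> D x \<in> tstar_carrier"
    and \<omega>: "\<And>x y. x \<in> tstar_carrier \<Longrightarrow> y \<in> tstar_carrier \<Longrightarrow> \<omega> x y = tform (D x) y"
    using tlinear_represents[OF lin(1)] by metis
  have tform_add: "tform (tadd x y) z = tform x z + tform y z"
    and tform_scale: "tform (tscale c x) z = c * tform x z"
    if "x \<in> tstar_carrier" "y \<in> tstar_carrier" "z \<in> tstar_carrier" for x y z :: "'a tstar" and c
    using tlinear_tform_left[OF that(3)] that by (auto simp: tlinear_def)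
  have scale_closed: "tscale c x \<in> tstar_carrier" if "x \<in> tstar_carrier" for c and x :: "'a tstar"
    using linear_compose_scale_right[of "snd x" c] that by (simp add: tstar_carrier_iff tscale_def)
  have "D (tadd x y) = tadd (D x) (D y)" if "x \<in> tstar_carrier" "y \<in> tstar_carrier" for x y
    by (rule tform_nondegenerate)
      (simp add: that tform_add D tadd_in_carrier add flip: \<omega>)
  moreover have "D (tscale c x) = tscale c (D x)" if "x \<in> tstar_carrier" for x c
    by (rule tform_nondegenerate)
      (simp add: that tform_scale[OF D[OF that] D[OF that]] scale_closed scale[OF that that] flip: \<omega>)
  moreover have "D (tbr br x y) = tadd (tbr br (D x) y) (tbr br x (D y))"
    if xy: "x \<in> tstar_carrier" "y \<in> tstar_carrier" for x y
  proof (rule tform_nondegenerate)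
    fix z :: "'a tstar" assume z: "z \<in> tstar_carrier"
    note cl = tbr_closed[OF lie]
    have "tform (tbr br x (D y)) z = - tform (D y) (tbr br x z)"
      unfolding tbr_antisym[OF lie D[OF xy(2)] xy(1)]
      by (simp add: tform_scale[OF cl[OF D[OF xy(2)] xy(1)] xy(1) z] tform_invariant[OF lie D[OF xy(2)] xy(1) z])
    also have "\<dots> = - \<omega> y (tbr br x z)" using xy z cl by (simp add: \<omega>)
    also have "\<dots> = \<omega> y (tbr br z x)"
      unfolding tbr_antisym[OF lie xy(1) z] using xy z cl by (simp add: scale(2)[OF cl[OF xy(1) z] z])
    also have "\<dots> = - \<omega> (tbr br z x) y" using alt xy z cl by metis
    finally have 1: "tform (tbr br x (D y)) z = - \<omega> (tbr br z x) y" .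
    have "tform (tbr br (D x) y) z = \<omega> x (tbr br y z)"
      using xy z cl D by (simp add: \<omega> tform_invariant[OF lie])
    also have "\<dots> = - \<omega> (tbr br y z) x" using alt xy z cl by metis
    finally have 2: "tform (tbr br (D x) y) z = - \<omega> (tbr br y z) x" .
    have "\<omega> (tbr br x y) z + \<omega> (tbr br y z) x + \<omega> (tbr br z x) y = 0"
      using coc xy z by (simp add: tstar_2cocycle_def)
    moreover have "tform (D (tbr br x y)) z = \<omega> (tbr br x y) z"
      using xy z cl by (simp add: \<omega>)
    moreover have "tform (tadd (tbr br (D x) y) (tbr br x (D y))) z =
        tform (tbr br (D x) y) z + tform (tbr br x (D y)) z"
      by (rule tform_add) (use xy z cl D in auto)
    ultimately show "tform (D (tbr br x y)) z = tform (tadd (tbr br (D x) y) (tbr br x (D y))) z"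
      using 1 2 by linarith
  qed
  ultimately have "tstar_derivation br D" using D by (simp add: tstar_derivation_def)
  moreover have "tstar_skew D"
    unfolding tstar_skew_def
  proof (intro ballI)
    fix x y :: "'a tstar" assume xy: "x \<in> tstar_carrier" "y \<in> tstar_carrier"
    show "tform (D x) y + tform x (D y) = 0"
      using alt[OF xy] \<omega>[OF xy] \<omega>[OF xy(2,1)] tform_sym[of x "D y"] by simp
  qed
  ultimately show thesis using that \<omega> by blast
qed

theorem mainTheorem7:
  fixes br :: "'a::euclidean_space \<Rightarrow> 'a \<Rightarrow> 'a"
  assumes "simple_lie_algebra br"
  shows "H2_tstar_trivial br \<and>
         (\<forall>D. tstar_derivation br D \<and> tstar_skew D \<longrightarrow> tstar_inner br D)"
proof
  note lie = simple_lie[OF assms]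
  show "\<forall>D. tstar_derivation br D \<and> tstar_skew D \<longrightarrow> tstar_inner br D"
    using skew_derivation_inner[OF assms] by blast
  show "H2_tstar_trivial br"
    unfolding H2_tstar_trivial_def
  proof (intro allI impI)
    fix \<omega> assume "tstar_2cocycle br \<omega>"
    then obtain D where D: "tstar_derivation br D" "tstar_skew D"
      and \<omega>: "\<And>x y. x \<in> tstar_carrier \<Longrightarrow> y \<in> tstar_carrier \<Longrightarrow> \<omega> x y = tform (D x) y"
      using cocycle_skew_derivation[OF lie] by blast
    obtain z where z: "z \<in> tstar_carrier" "\<And>x. x \<in> tstar_carrier \<Longrightarrow> D x = tbr br z x"
      using skew_derivation_inner[OF assms D] by (auto simp: tstar_inner_def)
    \<comment> \<open>Since D is bracketing with z, invariance exhibits \<omega> as the coboundary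
      of the functional \<open>tform z\<close>.\<close>
    have "\<omega> x y = tform z (tbr br x y)" if "x \<in> tstar_carrier" "y \<in> tstar_carrier" for x y
      using that z by (simp add: \<omega> tform_invariant[OF lie])
    then show "tstar_2coboundary br \<omega>"
      unfolding tstar_2coboundary_def using tlinear_tform_right[OF z(1)] by blast
  qed
qed

end
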